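(* Let $n\ge 1$ and let $T,V:\mathbb R^n\to\mathbb R^+=[0,+\infty)$ be convex, proper, even, and $2$-homogeneous. Assume that for some constant $C$ one has $T^L(q)\ge C\,V(q)$ for all $q\in\mathbb R^n$, with equality at some nonzero point $q_0\in\mathbb R^n$. Assume also that there exists a positive definite quadratic form $Q$ on $\mathbb R^n$ such that $$T^L(q)\ \ge\ Q(q)\ \ge\ C\,V(q)\qquad\text{for all } q\in\mathbb R^n.$$ Then for every $E>0$ the set $X=\{(p,q)\in\mathbb R^n\times\mathbb R^n\mid T(p)+V(q)\le E\}$ satisfies Viterbo's inequality $$\operatorname{vol}X\ \ge\ \frac{c_{EHZ}(X)^n}{n!}.$$
   Context: $\mathbb R^{2n}$ has coordinates $(p,q)=(p_1,\dots,p_n,q_1,\dots,q_n)$ and symplectic form $\omega=\sum_{i=1}^n dp_i\wedge dq_i$; $\operatorname{vol}$ is Lebesgue measure on $\mathbb R^{2n}$. A function is proper if it tends to $+\infty$ at infinity; $f$ is even and $2$-homogeneous if $f(tx)=t^2f(x)$ for all $t\in\mathbb R$ and all $x$. The Legendre transform of a lower semicontinuous convex function $f:\mathbb R^n\to\mathbb R$ is $f^L(y)=\sup_{x\in\mathbb R^n}\left(\langle y,x\rangle-f(x)\right)$, where $\langle\cdot,\cdot\rangle$ is the standard pairing. For a convex body $X\subset\mathbb R^{2n}$ with smooth boundary, a closed characteristic on $\partial X$ is a closed curve $\gamma$ in $\partial X$ whose velocity $\dot\gamma$ is nonzero and always lies in the one-dimensional kernel of the restriction of $\omega$ to $T\partial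 X$, oriented in the direction of the Hamiltonian flow $\dot q_i=\partial H/\partial p_i$, $\dot p_i=-\partial H/\partial q_i$ of a function $H$ having $X$ as a sublevel set with regular boundary level. Its action is $\int_\gamma\sum_{i=1}^n p_i\,dq_i$. The Ekeland--Hofer--Zehnder capacity $c_{EHZ}(X)$ is the smallest action of a closed characteristic on $\partial X$ for smooth convex $X$, and is extended to non-smooth convex bodies by continuity in the Hausdorff metric. *)

theory Defs
  imports "HOL-Analysis.Analysis"
begin

section \<open>Functions on configuration space\<close>

definition proper_fun :: "('a::real_normed_vector \<Rightarrow> real) \<Rightarrow> bool" where
  "proper_fun f \<longleftrightarrow> filterlim f at_top at_infinity"

definition even_2homogeneous :: "('a::real_vector \<Rightarrow> real) \<Rightarrow> bool" where
  "even_2homogeneous f \<longleftrightarrow> (\<forall>(t::real) x. f (t *\<^sub>R x) = t\<^sup>2 * f x)"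

definition legendre :: "('a::real_inner \<Rightarrow> real) \<Rightarrow> 'a \<Rightarrow> ereal" where
  "legendre f y = (SUP x. ereal (y \<bullet> x - f x))"

definition positive_definite_quadratic_form :: "(real ^ 'n \<Rightarrow> real) \<Rightarrow> bool" where
  "positive_definite_quadratic_form Q \<longleftrightarrow>
     (\<exists>A :: real ^ 'n ^ 'n. transpose A = A \<and> (\<forall>x. Q x = x \<bullet> (A *v x))) \<and>
     (\<forall>x. x \<noteq> 0 \<longrightarrow> 0 < Q x)"

section \<open>Phase space\<close>

text \<open>A point of phase space is the pair \<open>(p, q)\<close>, momenta first.\<close>

type_synonym 'n phase = "(real ^ 'n) \<times> (real ^ 'n)"

text \<open>\<open>(dp\<^sub>i \<and> dq\<^sub>i) (u, v) = dp\<^sub>i u * dq\<^sub>i v - dp\<^sub>i v * dq\<^sub>i u\<close>.\<close>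

definition omega :: "'n::finite phase \<Rightarrow> 'n phase \<Rightarrow> real" where
  "omega u v = (\<Sum>i\<in>UNIV. fst u $ i * snd v $ i - fst v $ i * snd u $ i)"

text \<open>The Hamiltonian vector field \<open>(- \<partial>H/\<partial>q, \<partial>H/\<partial>p)\<close>.\<close>

definition hamiltonian_field :: "('n::finite phase \<Rightarrow> real) \<Rightarrow> 'n phase \<Rightarrow> 'n phase" where
  "hamiltonian_field H x =
     ((\<chi> i. - frechet_derivative H (at x) (0, axis i 1)),
      (\<chi> i. frechet_derivative H (at x) (axis i 1, 0)))"

section \<open>Convex bodies with smooth boundary\<close>

text \<open>On a finite-dimensional space, \<open>Ck_fun k f\<close> says that \<open>f\<close> is of class \<open>C\<^sup>k\<close>:
  every iterated directional derivative of order less than \<open>k\<close> is differentiable, and those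
  of order \<open>k\<close> are continuous.\<close>

primrec Ck_fun :: "nat \<Rightarrow> ('a::real_normed_vector \<Rightarrow> real) \<Rightarrow> bool" where
  "Ck_fun 0 f \<longleftrightarrow> continuous_on UNIV f"
| "Ck_fun (Suc k) f \<longleftrightarrow> (\<forall>x. f differentiable (at x)) \<and>
     (\<forall>v. Ck_fun k (\<lambda>x. frechet_derivative f (at x) v))"

definition smooth_fun :: "('a::real_normed_vector \<Rightarrow> real) \<Rightarrow> bool" where
  "smooth_fun f \<longleftrightarrow> (\<forall>k. Ck_fun k f)"

definition convex_body :: "'a::euclidean_space set \<Rightarrow> bool" where
  "convex_body X \<longleftrightarrow> compact X \<and> convex X \<and> interior X \<noteq> {}"

definition defining_function :: "'a::euclidean_space set \<Rightarrow> ('a \<Rightarrow> real) \<Rightarrow> bool" where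
  "defining_function X H \<longleftrightarrow> smooth_fun H \<and> X = {x. H x \<le> 0} \<and> frontier X = {x. H x = 0} \<and>
     (\<forall>x. H x = 0 \<longrightarrow> (\<exists>v. frechet_derivative H (at x) v \<noteq> 0))"

definition smooth_convex_body :: "'a::euclidean_space set \<Rightarrow> bool" where
  "smooth_convex_body X \<longleftrightarrow> convex_body X \<and> (\<exists>H. defining_function X H)"

section \<open>Closed characteristics and the Ekeland--Hofer--Zehnder capacity\<close>

definition tangent_hyperplane :: "('a::euclidean_space \<Rightarrow> real) \<Rightarrow> 'a \<Rightarrow> 'a set" where
  "tangent_hyperplane H x = {v. frechet_derivative H (at x) v = 0}"

definition characteristic_line :: "('n::finite phase \<Rightarrow> real) \<Rightarrow> 'n phase \<Rightarrow> 'n phase set" where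
  "characteristic_line H x =
     {v \<in> tangent_hyperplane H x. \<forall>w \<in> tangent_hyperplane H x. omega v w = 0}"

text \<open>The kernel of \<open>omega\<close> on the tangent space and its orientation do not depend on the chosen
  defining function.  Since the kernel is a line spanned by the Hamiltonian vector, the sign
  of the inner product fixes the orientation.\<close>

definition closed_characteristic :: "'n::finite phase set \<Rightarrow> (real \<Rightarrow> 'n phase) \<Rightarrow> bool" where
  "closed_characteristic X \<gamma> \<longleftrightarrow>
     \<gamma> C1_differentiable_on {0..1} \<and> pathfinish \<gamma> = pathstart \<gamma> \<and>
     path_image \<gamma> \<subseteq> frontier X \<and>
     (\<exists>H. defining_function X H \<and>
       (\<forall>t\<in>{0..1}. let v = vector_derivative \<gamma> (at t) in
          v \<noteq> 0 \<and> v \<in> characteristic_line H (\<gamma> t) \<and>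
          0 < v \<bullet> hamiltonian_field H (\<gamma> t)))"

definition action :: "(real \<Rightarrow> 'n::finite phase) \<Rightarrow> real" where
  "action \<gamma> = integral {0..1} (\<lambda>t. fst (\<gamma> t) \<bullet> snd (vector_derivative \<gamma> (at t)))"

definition minimal_action :: "'n::finite phase set \<Rightarrow> ereal" where
  "minimal_action X = (INF \<gamma>\<in>{\<gamma>. closed_characteristic X \<gamma>}. ereal (action \<gamma>))"

definition hausdorff_dist :: "'a::metric_space set \<Rightarrow> 'a set \<Rightarrow> real" where
  "hausdorff_dist A B = max (SUP a\<in>A. infdist a B) (SUP b\<in>B. infdist b A)"

text \<open>The filter of smooth convex bodies tending to \<open>X\<close> in the Hausdorff metric.\<close>

definition smooth_bodies_near :: "'a::euclidean_space set \<Rightarrow> 'a set filter" where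
  "smooth_bodies_near X =
     (INF e\<in>{0<..}. principal {Y. smooth_convex_body Y \<and> hausdorff_dist Y X < e})"

text \<open>The value at a non-smooth body is the limit of the minimal action along smooth bodies
  tending to it.  Writing it as a lower limit makes the definition total without presupposing that
  the limit exists; the lemmas below show that it is the limit (hence the extension by
  continuity) as soon as the limit exists.\<close>

definition EHZ_capacity :: "'n::finite phase set \<Rightarrow> ereal" where
  "EHZ_capacity X =
     (if smooth_convex_body X then minimal_action X
      else Liminf (smooth_bodies_near X) minimal_action)"

lemma eventually_smooth_bodies_near:
  "eventually P (smooth_bodies_near X) \<longleftrightarrow>
     (\<exists>e>0. \<forall>Y. smooth_convex_body Y \<and> hausdorff_dist Y X < e \<longrightarrow> P Y)"
  unfolding smooth_bodies_near_def
  apply (subst eventually_INF_base)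
    apply force
   apply (rule_tac x = "min a b" in bexI; force)
  by (auto simp: eventually_principal)

lemma EHZ_capacity_eq_limit:
  assumes "\<not> smooth_convex_body X" "smooth_bodies_near X \<noteq> bot"
    and "(minimal_action \<longlongrightarrow> l) (smooth_bodies_near X)"
  shows "EHZ_capacity X = l"
  using lim_imp_Liminf[OF assms(2,3)] assms(1) by (simp add: EHZ_capacity_def)

lemma EHZ_capacity_eq_continuous_extension:
  assumes smooth: "\<And>Y. smooth_convex_body Y \<Longrightarrow> c Y = minimal_action Y"
    and dense: "smooth_bodies_near X \<noteq> bot"
    and cont: "(c \<longlongrightarrow> c X) (smooth_bodies_near X)"
  shows "EHZ_capacity X = c X"
proof (cases "smooth_convex_body X")
  case True
  then show ?thesis by (simp add: EHZ_capacity_def smooth)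
next
  case False
  have "\<forall>\<^sub>F Y in smooth_bodies_near X. c Y = minimal_action Y"
    unfolding eventually_smooth_bodies_near using smooth by (auto intro: exI[of _ 1])
  then have "(minimal_action \<longlongrightarrow> c X) (smooth_bodies_near X)"
    using cont by (simp add: tendsto_cong)
  with False dense show ?thesis by (rule EHZ_capacity_eq_limit)
qed

end

theory Submission
  imports Defs "HOL-Computational_Algebra.Polynomial"
begin

text \<open>
  The inequality rests on three observations.  Choose coordinates \<open>q = N v\<close> with
  \<open>Q (N v) = \<bar>v\<bar>\<^sup>2\<close> and \<open>p = W u\<close> with \<open>W\<close> the inverse transpose of \<open>N\<close>, so that
  \<open>(u, v) \<mapsto> (W u, N v)\<close> is symplectic.

  First, \<open>T\<^sup>L \<ge> Q\<close> dualizes to \<open>T (W u) \<le> \<bar>u\<bar>\<^sup>2 / 4\<close>, and \<open>C V (N v) \<le> \<bar>v\<bar>\<^sup>2\<close>.  Hence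
  \<open>X\<close> contains a symplectic ball of capacity \<open>\<pi> \<kappa>\<close> with \<open>\<kappa> = 2 E \<surd>C\<close>, and its volume is at least
  \<open>(\<pi> \<kappa>)\<^sup>n / n!\<close>, because linear symplectic maps preserve Lebesgue measure
  (\<open>symplectic_measure_preserving\<close>).

  Second, at the contact point \<open>q\<^sub>0 = N v\<^sub>0\<close> both \<open>T\<close> and \<open>V\<close> are bounded below by the
  square of one linear functional: \<open>T\<close> by duality, and \<open>V\<close> because a convex function that touches
  the smooth function \<open>Q / C\<close> from below inherits its tangent plane
  (\<open>linear_le_of_touching_norm\<close>).  So \<open>X\<close> lies in a cylinder over a disc in the symplectic plane
  spanned by \<open>(W v\<^sub>0, 0)\<close> and \<open>(0, q\<^sub>0)\<close>, and it contains the boundary circle of that disc, an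
  ellipse enclosing symplectic area \<open>\<pi> \<kappa>\<close>.

  Third, whenever a smooth convex body contains such a circle and lies in the cylinder over it, its
  tangent hyperplanes along the circle are those of the cylinder, and the circle is a closed
  characteristic of action \<open>\<pi> \<kappa>\<close> (\<open>circle_closed_characteristic\<close>).

  This bounds the capacity by \<open>\<pi> \<kappa>\<close> when \<open>X\<close> is smooth.  Otherwise the capacity is a lower limit,
  and it suffices to find smooth bodies arbitrarily close to \<open>X\<close> that
  still contain the circle and stay inside the cylinder.  They are sublevel sets
  of \<open>c + K \<Sum>\<^sub>i g (a\<^sub>i \<bullet> z - 1)\<close>, where \<open>c\<close> is the quadratic form of the cylinder,
  the half-spaces \<open>a\<^sub>i \<bullet> z \<le> 1\<close> contain \<open>X\<close> and cut out a set close to it, and \<open>g\<close> is smooth,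
  convex and zero exactly on the nonpositive reals (\<open>smooth_outer_approximation\<close>): on \<open>X\<close> the
  function equals \<open>c\<close>, outside it is at least \<open>c\<close>.

  Finally, the upper bound on the capacity can be raised to the \<open>n\<close>-th power only because the
  capacity is nonnegative, which follows from the positive orientation of characteristics on
  convex bodies (\<open>action_nonneg\<close>).
\<close>

section \<open>Smooth functions\<close>

text \<open>The derivatives of \<open>exp (- 1 / s)\<close> and \<open>s exp (- 1 / s)\<close>, extended by zero to \<open>s \<le> 0\<close>,
  are of this form; allowing
  an arbitrary polynomial in \<open>1 / s\<close> makes the class closed under differentiation.\<close>
definition flat :: "real poly \<Rightarrow> real \<Rightarrow> real" where
  "flat P s = (if s \<le> 0 then 0 else poly P (inverse s) * exp (- inverse s))"

lemma poly_exp_decay: "((\<lambda>x::real. poly P x * exp (- x)) \<longlongrightarrow> 0) at_top"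
proof -
  have "((\<lambda>x::real. \<Sum>i\<le>degree P. coeff P i * (x ^ i / exp x)) \<longlongrightarrow> (\<Sum>i\<le>degree P. coeff P i * 0)) at_top"
    by (intro tendsto_intros tendsto_power_div_exp_0)
  then show ?thesis
    by (simp add: poly_altdef exp_minus sum_distrib_right sum_divide_distrib field_simps)
qed

lemma poly_exp_decay_at_right:
  "((\<lambda>h::real. poly P (inverse h) * exp (- inverse h)) \<longlongrightarrow> 0) (at_right 0)"
  using filterlim_compose[OF poly_exp_decay filterlim_inverse_at_top_right] .

text \<open>Smoothness of the functions below is in question only at the origin, where the difference
  quotient vanishes on the left and decays exponentially on the right.\<close>
lemma has_real_derivative_one_sided_zero:
  fixes f g :: "real \<Rightarrow> real"
  assumes "\<And>s. s \<le> 0 \<Longrightarrow> f s = 0" and "\<And>s. 0 < s \<Longrightarrow> f s / s = g s"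
    and "(g \<longlongrightarrow> 0) (at_right 0)"
  shows "(f has_real_derivative 0) (at 0)"
proof -
  have "((\<lambda>h. f h / h) \<longlongrightarrow> 0) (at_left 0)"
    by (rule Lim_transform_eventually[OF tendsto_const])
       (auto simp: eventually_at_filter assms(1))
  moreover have "((\<lambda>h. f h / h) \<longlongrightarrow> 0) (at_right 0)"
    by (rule Lim_transform_eventually[OF assms(3)])
       (auto simp: eventually_at_filter assms(2))
  ultimately show ?thesis
    by (simp add: has_field_derivative_iff assms(1) filterlim_split_at)
qed

text \<open>In the variable \<open>x = 1 / s\<close> differentiation is \<open>- x\<^sup>2 d/dx\<close>, which sends \<open>P(x) exp (- x)\<close> to
  \<open>x\<^sup>2 (P(x) - P'(x)) exp (- x)\<close>.\<close>
lemma flat_has_derivative: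
  "(flat P has_real_derivative flat (monom 1 2 * (P - pderiv P)) s) (at s)"
proof -
  consider "s < 0" | "s = 0" | "0 < s" by linarith
  then show ?thesis
  proof cases
    case 1
    have "((\<lambda>s. 0) has_real_derivative 0) (at s)" by simp
    then have "(flat P has_real_derivative 0) (at s)"
      by (rule has_field_derivative_transform_within_open[where S="{..<0}"])
         (use 1 in \<open>auto simp: flat_def\<close>)
    then show ?thesis using 1 by (simp add: flat_def)
  next
    case 2
    have "(flat P has_real_derivative 0) (at 0)"
      by (rule has_real_derivative_one_sided_zero[OF _ _ poly_exp_decay_at_right[of "pCons 0 P"]])
         (auto simp: flat_def divide_inverse)
    then show ?thesis using 2 by (simp add: flat_def)
  next
    case 3
    have "((\<lambda>s. poly P (inverse s) * exp (- inverse s)) has_real_derivative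
        flat (monom 1 2 * (P - pderiv P)) s) (at s)"
      using 3 unfolding flat_def
      by (auto intro!: derivative_eq_intros simp: poly_monom field_simps power2_eq_square)
    then show ?thesis
      by (rule has_field_derivative_transform_within_open[where S="{0<..}"])
         (use 3 in \<open>auto simp: flat_def\<close>)
  qed
qed

text \<open>The factor \<open>s\<close> matters: \<open>exp (- 1 / s)\<close> alone is convex only near the origin, whereas the second
  derivative of \<open>s exp (- 1 / s)\<close> is \<open>exp (- 1 / s) / s\<^sup>3\<close>.\<close>
definition barrier :: "real \<Rightarrow> real" where
  "barrier s = (if s \<le> 0 then 0 else s * exp (- inverse s))"

lemma barrier_nonpos [simp]: "s \<le> 0 \<Longrightarrow> barrier s = 0"
  and barrier_pos: "0 < s \<Longrightarrow> 0 < barrier s"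
  and barrier_nonneg: "0 \<le> barrier s"
  by (auto simp: barrier_def)

lemma barrier_has_derivative: "(barrier has_real_derivative flat [:1, 1:] s) (at s)"
proof -
  consider "s < 0" | "s = 0" | "0 < s" by linarith
  then show ?thesis
  proof cases
    case 1
    have "((\<lambda>s. 0) has_real_derivative 0) (at s)" by simp
    then have "(barrier has_real_derivative 0) (at s)"
      by (rule has_field_derivative_transform_within_open[where S="{..<0}"])
         (use 1 in \<open>auto simp: barrier_def\<close>)
    then show ?thesis using 1 by (simp add: flat_def)
  next
    case 2
    have "(barrier has_real_derivative 0) (at 0)"
      by (rule has_real_derivative_one_sided_zero[OF _ _ poly_exp_decay_at_right[of "1"]])
         (auto simp: barrier_def divide_inverse)
    then show ?thesis using 2 by (simp add: flat_def)
  next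
    case 3
    have "((\<lambda>s. s * exp (- inverse s)) has_real_derivative flat [:1, 1:] s) (at s)"
      using 3 unfolding flat_def
      by (auto intro!: derivative_eq_intros simp: field_simps power2_eq_square)
    then show ?thesis
      by (rule has_field_derivative_transform_within_open[where S="{0<..}"])
         (use 3 in \<open>auto simp: barrier_def\<close>)
  qed
qed

lemma convex_barrier: "convex_on UNIV barrier"
proof (rule f''_ge0_imp_convex)
  show "(barrier has_real_derivative flat [:1, 1:] s) (at s)" for s
    by (rule barrier_has_derivative)
  show "(flat [:1, 1:] has_real_derivative flat (monom 1 2 * ([:1,1:] - pderiv [:1,1:])) s) (at s)" for s
    by (rule flat_has_derivative)
  show "0 \<le> flat (monom 1 2 * ([:1,1:] - pderiv [:1,1:])) s" for s
    by (simp add: flat_def poly_monom pderiv_pCons)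
qed simp

text \<open>The whole sequence of derivatives is produced at once, since the proof that a function of a
  linear functional is smooth has to refer to all of them simultaneously.\<close>
definition smooth_real :: "(real \<Rightarrow> real) \<Rightarrow> bool" where
  "smooth_real f \<longleftrightarrow> (\<exists>D. D 0 = f \<and> (\<forall>k s. (D k has_real_derivative D (Suc k) s) (at s)))"

lemma smooth_real_barrier: "smooth_real barrier"
proof -
  define P where "P k = ((\<lambda>P. monom 1 2 * (P - pderiv P)) ^^ k) [:1, 1 :: real:]" for k
  define D where "D k = (case k of 0 \<Rightarrow> barrier | Suc j \<Rightarrow> flat (P j))" for k
  have "(D k has_real_derivative D (Suc k) s) (at s)" for k s
    using barrier_has_derivative[of s] flat_has_derivative[of "P (k - 1)" s]
    by (cases k) (simp_all add: D_def P_def)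
  then show ?thesis unfolding smooth_real_def by (intro exI[of _ D]) (simp add: D_def)
qed

lemma smooth_real_square: "smooth_real (\<lambda>s. s\<^sup>2)"
proof -
  define D where "D k = (if k = 0 then (\<lambda>s::real. s\<^sup>2) else if k = 1 then (\<lambda>s. 2 * s)
      else if k = 2 then (\<lambda>s. 2) else (\<lambda>s. 0))" for k :: nat
  have "(D k has_real_derivative D (Suc k) s) (at s)" for k s
    unfolding D_def by (auto intro!: derivative_eq_intros)
  then show ?thesis unfolding smooth_real_def by (intro exI[of _ D]) (simp add: D_def)
qed

lemma Ck_fun_const: "Ck_fun k (\<lambda>x. c)"
proof (induction k arbitrary: c)
  case (Suc k)
  then show ?case by simp
qed simp

lemma Ck_fun_add: "Ck_fun k f \<Longrightarrow> Ck_fun k g \<Longrightarrow> Ck_fun k (\<lambda>x. f x + g x)"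
proof (induction k arbitrary: f g)
  case 0
  then show ?case by (simp add: continuous_on_add)
next
  case (Suc k)
  then have "(f has_derivative frechet_derivative f (at x)) (at x)"
    and "(g has_derivative frechet_derivative g (at x)) (at x)" for x
    by (simp_all add: frechet_derivative_works[symmetric])
  then have "frechet_derivative (\<lambda>x. f x + g x) (at x) v
      = frechet_derivative f (at x) v + frechet_derivative g (at x) v" for x v
    by (metis frechet_derivative_at has_derivative_add)
  with Suc show ?case by simp
qed

text \<open>The derivative of \<open>r f (a \<bullet> x - b)\<close> in direction \<open>v\<close> is \<open>(r (a \<bullet> v)) f' (a \<bullet> x - b)\<close>, a function
  of the same shape.  The induction therefore runs over all factors \<open>r\<close> and all orders \<open>k\<close>.\<close>
lemma Ck_fun_ridge:
  fixes a :: "'a::real_inner"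
  assumes D: "\<And>k s. (D k has_real_derivative D (Suc k) s) (at s)"
  shows "Ck_fun j (\<lambda>x. r * D k (a \<bullet> x - b))"
proof (induction j arbitrary: k r)
  have deriv: "((\<lambda>x. r * D k (a \<bullet> x - b)) has_derivative
      (\<lambda>v. r * (D (Suc k) (a \<bullet> x - b) * (a \<bullet> v)))) (at x)" for k r x
    by (rule has_derivative_mult_right)
       (rule has_derivative_compose[OF _ D[unfolded has_field_derivative_def], THEN has_derivative_eq_rhs],
         (rule derivative_eq_intros | simp)+)
  {
    case 0
    have "((\<lambda>x. r * D k (a \<bullet> x - b)) differentiable at x)" for x
      using deriv differentiable_def by blast
    then show ?case
      by (simp add: continuous_at_imp_continuous_on differentiable_imp_continuous_within)
  next
    case (Suc j)
    have "frechet_derivative (\<lambda>x. r * D k (a \<bullet> x - b)) (at x) v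
        = (r * (a \<bullet> v)) * D (Suc k) (a \<bullet> x - b)" for x v
      by (simp add: frechet_derivative_at[OF deriv, symmetric])
    moreover have "(\<lambda>x. r * D k (a \<bullet> x - b)) differentiable at x" for x
      using deriv differentiable_def by blast
    ultimately show ?case using Suc by simp
  }
qed

lemma smooth_fun_const: "smooth_fun (\<lambda>x. c)"
  by (simp add: smooth_fun_def Ck_fun_const)

lemma smooth_fun_add: "smooth_fun f \<Longrightarrow> smooth_fun g \<Longrightarrow> smooth_fun (\<lambda>x. f x + g x)"
  by (simp add: smooth_fun_def Ck_fun_add)

lemma smooth_fun_sum:
  assumes "\<And>i. i \<in> I \<Longrightarrow> smooth_fun (f i)"
  shows "smooth_fun (\<lambda>x. \<Sum>i\<in>I. f i x)"
  using assms
  by (induction I rule: infinite_finite_induct) (auto intro: smooth_fun_const smooth_fun_add)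

lemma smooth_fun_ridge:
  assumes "smooth_real f"
  shows "smooth_fun (\<lambda>x. r * f (a \<bullet> x - b))"
proof -
  obtain D where "D 0 = f" and "\<And>k s. (D k has_real_derivative D (Suc k) s) (at s)"
    using assms unfolding smooth_real_def by blast
  then show ?thesis
    using Ck_fun_ridge[of D _ r 0 a b] by (simp add: smooth_fun_def)
qed

section \<open>Convex functions that are homogeneous of degree two\<close>

lemma convex_sublevel_set:
  assumes "convex_on UNIV f"
  shows "convex {x. f x \<le> k}"
proof (rule convexI)
  fix x y u v assume *: "x \<in> {x. f x \<le> k}" "y \<in> {x. f x \<le> k}" "(0::real) \<le> u" "0 \<le> v" "u + v = 1"
  have "f (u *\<^sub>R x + v *\<^sub>R y) \<le> u * f x + v * f y"
    using assms * by (simp add: convex_on_def)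
  also have "\<dots> \<le> k" using * by (simp add: convex_bound_le)
  finally show "u *\<^sub>R x + v *\<^sub>R y \<in> {x. f x \<le> k}" by simp
qed

text \<open>These functions are the squares of norms.  Besides \<open>T\<close> and \<open>V\<close>, the locale is applied to
  \<open>T (p) + V (q)\<close> on phase space.\<close>
locale quadratic_gauge =
  fixes F :: "'a::euclidean_space \<Rightarrow> real"
  assumes convex: "convex_on UNIV F"
    and scale: "F (t *\<^sub>R x) = t\<^sup>2 * F x"
    and pos: "x \<noteq> 0 \<Longrightarrow> 0 < F x"
begin

lemma zero [simp]: "F 0 = 0"
  using scale[of 0 0] by simp

lemma nonneg: "0 \<le> F x"
  using pos[of x] by (cases "x = 0") auto

lemma continuous: "continuous_on UNIV F"
  by (rule convex_on_continuous[OF open_UNIV convex])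

text \<open>The constant is the minimum over the unit sphere; homogeneity does the rest.\<close>
lemma coercive: obtains \<mu> where "0 < \<mu>" "\<And>x. \<mu> * (norm x)\<^sup>2 \<le> F x"
proof -
  have "sphere (0::'a) 1 \<noteq> {}" by simp
  then obtain x0 :: 'a where x0: "x0 \<in> sphere 0 1" and min: "\<And>x. x \<in> sphere 0 1 \<Longrightarrow> F x0 \<le> F x"
    using continuous_attains_inf[of "sphere 0 1" F] continuous_on_subset[OF continuous]
    by (metis compact_sphere subset_UNIV)
  show thesis
  proof
    show "0 < F x0" using x0 by (intro pos) auto
    show "F x0 * (norm x)\<^sup>2 \<le> F x" for x
    proof (cases "x = 0")
      case False
      have "F x0 * (norm x)\<^sup>2 \<le> F ((1 / norm x) *\<^sub>R x) * (norm x)\<^sup>2"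
        using False by (intro mult_right_mono min) auto
      also have "\<dots> = F x" using False by (simp add: scale power_divide)
      finally show ?thesis .
    qed simp
  qed
qed

lemma compact_sublevel: "compact {x. F x \<le> k}"
proof -
  obtain \<mu> where \<mu>: "0 < \<mu>" "\<And>x. \<mu> * (norm x)\<^sup>2 \<le> F x"
    using coercive by metis
  have "norm x \<le> sqrt (k / \<mu>)" if "F x \<le> k" for x
    using \<mu>(1) order_trans[OF \<mu>(2) that] by (intro real_le_rsqrt) (simp add: field_simps)
  then have "bounded {x. F x \<le> k}" by (auto simp: bounded_iff)
  moreover have "closed {x. F x \<le> k}"
    by (rule closed_Collect_le[OF continuous]) simp
  ultimately show ?thesis by (simp add: compact_eq_bounded_closed)
qed

lemma convex_sublevel: "convex {x. F x \<le> k}"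
  by (rule convex_sublevel_set[OF convex])

lemma convex_sublevel_strict: "convex {x. F x < k}"
proof (rule convexI)
  fix x y u v assume *: "x \<in> {x. F x < k}" "y \<in> {x. F x < k}" "(0::real) \<le> u" "0 \<le> v" "u + v = 1"
  have "F (u *\<^sub>R x + v *\<^sub>R y) \<le> u * F x + v * F y"
    using convex * by (simp add: convex_on_def)
  also have "\<dots> < k" using * by (simp add: convex_bound_lt)
  finally show "u *\<^sub>R x + v *\<^sub>R y \<in> {x. F x < k}" by simp
qed

text \<open>A hyperplane through \<open>x\<close> that avoids the open set \<open>{z. F z < F x}\<close> is given by a functional \<open>a\<close>.
  By homogeneity it bounds \<open>F\<close> below by a multiple of the square of \<open>a\<close>,
  with equality at \<open>x\<close>, and the inequality between arithmetic and geometric means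
  turns this into a supporting affine function.  With the normalization \<open>y \<bullet> x = 2 F x\<close> it says
  that \<open>y\<close> is a subgradient at \<open>x\<close> and that the conjugate of \<open>F\<close> at \<open>y\<close> is \<open>F x\<close>.\<close>
lemma subgradient:
  obtains y where "y \<bullet> x = 2 * F x" "\<And>z. y \<bullet> z \<le> F z + F x"
proof (cases "x = 0")
  case True
  then show thesis using that[of 0] by (simp add: nonneg)
next
  case False
  have "convex ((\<lambda>z. x - z) ` {z. F z < F x})"
    using convex_translation[OF convex_negations[OF convex_sublevel_strict], of x "F x"]
    by (simp add: image_image)
  then obtain a where a: "a \<noteq> 0" and sep: "\<And>z. F z < F x \<Longrightarrow> a \<bullet> z \<le> a \<bullet> x"
    using separating_hyperplane_set_0[of "(\<lambda>z. x - z) ` {z. F z < F x}"]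
    by (force simp: inner_diff_right)
  have ax: "0 < a \<bullet> x"
  proof -
    have "((\<lambda>e. e\<^sup>2 * F a) \<longlongrightarrow> 0\<^sup>2 * F a) (at_right 0)"
      by (intro tendsto_intros)
    then have "\<forall>\<^sub>F e in at_right 0. e\<^sup>2 * F a < F x"
      by (rule order_tendstoD) (simp add: pos False)
    then have "\<forall>\<^sub>F e in at_right 0. e\<^sup>2 * F a < F x \<and> 0 < e"
      by (simp add: eventually_conj_iff eventually_at_filter)
    then obtain e where "e\<^sup>2 * F a < F x" "0 < e"
      using eventually_happens trivial_limit_at_right_real by blast
    then show ?thesis
      using sep[of "e *\<^sub>R a"] a by (simp add: scale) (smt (verit) inner_gt_zero_iff mult_pos_pos)
  qed
  define u where "u z = (a \<bullet> z) / (a \<bullet> x)" for z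
  have key: "(u z)\<^sup>2 * F x \<le> F z" if "0 < u z" for z
  proof (rule ccontr)
    assume "\<not> ?thesis"
    then have "F z / F x < (u z)\<^sup>2" using pos[OF False] by (simp add: field_simps)
    \<comment> \<open>the point \<open>z / \<surd>k\<close> would lie strictly below the level of \<open>x\<close>, yet beyond the hyperplane\<close>
    then obtain k where k: "F z / F x < k" "k < (u z)\<^sup>2" using dense by blast
    have k0: "0 < k"
      using k(1) nonneg[of z] pos[OF False] by (smt (verit) divide_nonneg_pos)
    have "F ((1 / sqrt k) *\<^sub>R z) < F x"
      using k(1) k0 pos[OF False] by (simp add: scale power_divide field_simps)
    then have "a \<bullet> z / sqrt k \<le> a \<bullet> x" using sep by fastforce
    then have "u z \<le> sqrt k" using k0 ax by (simp add: u_def field_simps)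
    moreover have "sqrt k < u z" using k(2) that by (simp add: real_less_lsqrt)
    ultimately show False by simp
  qed
  have "2 * F x * u z \<le> F z + F x" for z
  proof (cases "0 < u z")
    case True
    have "0 \<le> F x * (u z - 1)\<^sup>2" by (simp add: nonneg)
    then show ?thesis using key[OF True] by (simp add: power2_eq_square algebra_simps)
  next
    case False
    then have "2 * F x * u z \<le> 0" by (simp add: mult_nonneg_nonpos nonneg)
    then show ?thesis using nonneg[of z] nonneg[of x] by linarith
  qed
  then show thesis
    using ax that[of "(2 * F x / (a \<bullet> x)) *\<^sub>R a"] by (simp add: u_def)
qed

end

text \<open>Apply the affine bound to \<open>t x\<close> and divide by \<open>t\<^sup>2\<close>; the best choice is \<open>t = 2 m / (a \<bullet> x)\<close>.\<close>
lemma square_le_of_linear_le: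
  fixes f :: "'a::real_inner \<Rightarrow> real"
  assumes scale: "\<And>t x. f (t *\<^sub>R x) = t\<^sup>2 * f x" and "\<And>x. 0 \<le> f x"
    and le: "\<And>x. a \<bullet> x - m \<le> f x" and m: "0 < m"
  shows "(a \<bullet> x)\<^sup>2 / (4 * m) \<le> f x"
proof (cases "a \<bullet> x = 0")
  case False
  define t where "t = 2 * m / (a \<bullet> x)"
  have "m \<le> t\<^sup>2 * f x" using le[of "t *\<^sub>R x"] False by (simp add: scale t_def)
  moreover have "0 < t\<^sup>2" using False m by (simp add: t_def)
  ultimately have "m / t\<^sup>2 \<le> f x" by (simp add: divide_le_eq mult.commute)
  moreover have "m / t\<^sup>2 = (a \<bullet> x)\<^sup>2 / (4 * m)" using m by (simp add: t_def power2_eq_square)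
  ultimately show ?thesis by simp
qed (simp add: assms)

text \<open>The lower bound at \<open>v\<close> comes from the upper bound on the opposite side of the contact point:
  \<open>v0\<close> is a convex combination of \<open>v\<close> and \<open>v0 - \<tau> (v - v0)\<close>.  The error
  of the upper bound is quadratic in \<open>\<tau>\<close> and disappears as \<open>\<tau>\<close> tends to zero.\<close>
lemma linear_le_of_touching_norm:
  fixes f :: "'a::real_inner \<Rightarrow> real"
  assumes convex: "convex_on UNIV f" and le: "\<And>v. f v \<le> v \<bullet> v" and eq: "f v0 = v0 \<bullet> v0"
  shows "2 * (v0 \<bullet> v) - v0 \<bullet> v0 \<le> f v"
proof -
  define w where "w = v - v0"
  have bound: "v0 \<bullet> v0 + 2 * (v0 \<bullet> w) - \<tau> * (w \<bullet> w) \<le> f v" if "0 < \<tau>" for \<tau>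
  proof -
    have "v0 = (\<tau> / (1 + \<tau>)) *\<^sub>R v + (1 / (1 + \<tau>)) *\<^sub>R (v0 - \<tau> *\<^sub>R w)"
    proof -
      have "(1 + \<tau>) *\<^sub>R v0 = (1 + \<tau>) *\<^sub>R ((\<tau> / (1 + \<tau>)) *\<^sub>R v + (1 / (1 + \<tau>)) *\<^sub>R (v0 - \<tau> *\<^sub>R w))"
        using that by (simp add: w_def scaleR_right_distrib) (simp add: algebra_simps)
      then show ?thesis using that by (subst (asm) real_vector.scale_cancel_left) auto
    qed
    moreover have "f ((\<tau> / (1 + \<tau>)) *\<^sub>R v + (1 / (1 + \<tau>)) *\<^sub>R (v0 - \<tau> *\<^sub>R w))
        \<le> (\<tau> / (1 + \<tau>)) * f v + (1 / (1 + \<tau>)) * f (v0 - \<tau> *\<^sub>R w)"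
    proof -
      have "0 \<le> \<tau> / (1 + \<tau>)" "0 \<le> 1 / (1 + \<tau>)" "\<tau> / (1 + \<tau>) + 1 / (1 + \<tau>) = 1"
        using that by (simp_all add: add_divide_distrib[symmetric])
      then show ?thesis using convex unfolding convex_on_def by blast
    qed
    ultimately have "f v0 \<le> (\<tau> / (1 + \<tau>)) * f v + (1 / (1 + \<tau>)) * f (v0 - \<tau> *\<^sub>R w)"
      by metis
    also have "\<dots> = (\<tau> * f v + f (v0 - \<tau> *\<^sub>R w)) / (1 + \<tau>)"
      by (simp add: add_divide_distrib)
    finally have "(1 + \<tau>) * f v0 \<le> \<tau> * f v + f (v0 - \<tau> *\<^sub>R w)"
      using that by (simp add: pos_le_divide_eq mult.commute)
    also have "\<dots> \<le> \<tau> * f v + (v0 - \<tau> *\<^sub>R w) \<bullet> (v0 - \<tau> *\<^sub>R w)"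
      using le by simp
    finally have "\<tau> * (v0 \<bullet> v0 + 2 * (v0 \<bullet> w) - \<tau> * (w \<bullet> w)) \<le> \<tau> * f v"
      by (simp add: eq inner_diff inner_commute algebra_simps)
    then show ?thesis using that by simp
  qed
  have "((\<lambda>\<tau>. v0 \<bullet> v0 + 2 * (v0 \<bullet> w) - \<tau> * (w \<bullet> w)) \<longlongrightarrow> v0 \<bullet> v0 + 2 * (v0 \<bullet> w) - 0 * (w \<bullet> w))
      (at_right (0::real))"
    by (intro tendsto_intros)
  then have "v0 \<bullet> v0 + 2 * (v0 \<bullet> w) - 0 * (w \<bullet> w) \<le> f v"
    by (rule tendsto_upperbound) (auto simp: eventually_at_filter bound)
  then show ?thesis by (simp add: w_def inner_diff_right)
qed

section \<open>Smooth outer approximation\<close>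

text \<open>A zero of \<open>H\<close> in the interior of \<open>{H \<le> 0}\<close> would be a local maximum, hence a critical point.\<close>
lemma frontier_sublevel:
  fixes H :: "'a::euclidean_space \<Rightarrow> real"
  assumes cont: "continuous_on UNIV H"
    and deriv: "\<And>x. H x = 0 \<Longrightarrow> H differentiable at x \<and> (\<exists>v. frechet_derivative H (at x) v \<noteq> 0)"
  shows "frontier {x. H x \<le> 0} = {x. H x = 0}"
proof -
  have cl: "closed {x. H x \<le> 0}" by (rule closed_Collect_le[OF cont]) simp
  have op: "open {x. H x < 0}" by (rule open_Collect_less[OF cont]) simp
  have "{x. H x < 0} \<subseteq> interior {x. H x \<le> 0}"
    by (rule interior_maximal[OF _ op]) auto
  moreover have "x \<notin> interior {x. H x \<le> 0}" if "H x = 0" for x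
  proof
    assume x: "x \<in> interior {x. H x \<le> 0}"
    have "frechet_derivative H (at x) = (\<lambda>v. 0)"
    proof (rule differential_zero_maxmin[where S="interior {x. H x \<le> 0}" and f=H and x=x])
      show "(H has_derivative frechet_derivative H (at x)) (at x)"
        using deriv[OF that] frechet_derivative_works by blast
      show "(\<forall>y\<in>interior {x. H x \<le> 0}. H y \<le> H x) \<or> (\<forall>y\<in>interior {x. H x \<le> 0}. H x \<le> H y)"
        using interior_subset that by fastforce
    qed (use x in auto)
    then show False using deriv[OF that] by auto
  qed
  ultimately have "interior {x. H x \<le> 0} = {x. H x < 0}"
    using interior_subset[of "{x. H x \<le> 0}"] by force
  then show ?thesis using cl by (auto simp: frontier_def)
qed

lemma smooth_fun_differentiable: "smooth_fun f \<Longrightarrow> f differentiable at x"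
  unfolding smooth_fun_def by (metis Ck_fun.simps(2))

lemma smooth_fun_continuous: "smooth_fun f \<Longrightarrow> continuous_on UNIV f"
  unfolding smooth_fun_def by (metis Ck_fun.simps(1))

lemma directional_derivative:
  assumes "H differentiable at (x :: 'a::real_normed_vector)"
  shows "((\<lambda>t. H (x + t *\<^sub>R w)) has_real_derivative frechet_derivative H (at x) w) (at 0)"
proof -
  have "(H has_derivative frechet_derivative H (at x)) (at (x + 0 *\<^sub>R w))"
    using assms unfolding frechet_derivative_works by simp
  moreover have "((\<lambda>t. x + t *\<^sub>R w) has_derivative (\<lambda>t. t *\<^sub>R w)) (at 0)"
    by (auto intro!: derivative_eq_intros)
  ultimately have "((\<lambda>t. H (x + t *\<^sub>R w)) has_derivative (\<lambda>t. frechet_derivative H (at x) (t *\<^sub>R w))) (at 0)"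
    using diff_chain_at[of "\<lambda>t. x + t *\<^sub>R w" "\<lambda>t. t *\<^sub>R w" 0 H] by (simp add: o_def)
  then show ?thesis
    using linear_scale[OF linear_frechet_derivative[OF assms]]
    by (simp add: has_field_derivative_def mult_commute_abs)
qed

text \<open>Regularity of the boundary is automatic: a convex function that is negative at the origin has
  nonzero radial derivative wherever it vanishes, since otherwise the tangent to its restriction to
  the ray would bound the value at the origin from below by zero.\<close>
lemma smooth_convex_body_sublevel:
  fixes G :: "'a::euclidean_space \<Rightarrow> real"
  assumes smooth: "smooth_fun G" and convex: "convex_on UNIV G" and "G 0 < k"
    and bounded: "bounded {x. G x \<le> k}"
  shows "smooth_convex_body {x. G x \<le> k}"
proof -
  define H where "H x = G x + (- k)" for x
  have smoothH: "smooth_fun H" unfolding H_def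
    by (intro smooth_fun_add smooth smooth_fun_const)
  have contH: "continuous_on UNIV H" by (rule smooth_fun_continuous[OF smoothH])
  have diffH: "H differentiable at x" for x by (rule smooth_fun_differentiable[OF smoothH])
  have eq: "{x. G x \<le> k} = {x. H x \<le> 0}" by (auto simp: H_def)
  have H0: "H 0 < 0" using assms by (simp add: H_def)
  have nz: "frechet_derivative H (at x) x \<noteq> 0" if "H x = 0" for x
  proof
    assume 0: "frechet_derivative H (at x) x = 0"
    have convexH: "convex_on UNIV H" unfolding H_def
      by (intro convex_on_add convex) (simp add: convex_on_const)
    have "convex_on UNIV (\<lambda>t::real. H (x + t *\<^sub>R (- x)))"
    proof (rule convex_onI)
      fix t s s' :: real assume t: "0 < t" "t < 1"
      have "x + ((1 - t) *\<^sub>R s + t *\<^sub>R s') *\<^sub>R (- x)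
        = (1 - t) *\<^sub>R (x + s *\<^sub>R (- x)) + t *\<^sub>R (x + s' *\<^sub>R (- x))"
        by (simp add: algebra_simps)
      then show "H (x + ((1 - t) *\<^sub>R s + t *\<^sub>R s') *\<^sub>R (- x))
        \<le> (1 - t) * H (x + s *\<^sub>R (- x)) + t * H (x + s' *\<^sub>R (- x))"
        using convex_onD[OF convexH, of t "x + s *\<^sub>R (- x)" "x + s' *\<^sub>R (- x)"] t by simp
    qed simp
    moreover have "((\<lambda>t. H (x + t *\<^sub>R (- x))) has_real_derivative 0) (at 0)"
      using directional_derivative[OF diffH, of x "- x"] 0
        linear_neg[OF linear_frechet_derivative[OF diffH], of x x] by simp
    ultimately have "H (x + 1 *\<^sub>R (- x)) - H (x + 0 *\<^sub>R (- x)) \<ge> 0 * (1 - 0)"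
      by (intro convex_on_imp_above_tangent[where A=UNIV]) auto
    then show False using H0 that by simp
  qed
  have "frontier {x. H x \<le> 0} = {x. H x = 0}"
    using nz smooth_fun_differentiable[OF smoothH] by (intro frontier_sublevel[OF contH]) blast
  then have "defining_function {x. G x \<le> k} H"
    unfolding defining_function_def eq using smoothH nz by blast
  moreover have "interior {x. G x \<le> k} \<noteq> {}"
  proof -
    have "open {x. H x < 0}" by (rule open_Collect_less[OF contH]) simp
    then have "{x. H x < 0} \<subseteq> interior {x. H x \<le> 0}" by (intro interior_maximal) auto
    then show ?thesis using H0 eq by auto
  qed
  moreover have "closed {x. G x \<le> k}"
    by (rule closed_Collect_le[OF smooth_fun_continuous[OF smooth]]) simp
  ultimately show ?thesis
    unfolding smooth_convex_body_def convex_body_def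
    using bounded convex_sublevel_set[OF convex] by (auto simp: compact_eq_bounded_closed)
qed

lemma convex_on_ridge:
  fixes a :: "'a::real_inner"
  assumes "convex_on UNIV f"
  shows "convex_on UNIV (\<lambda>x. f (a \<bullet> x - b))"
proof (rule convex_onI)
  fix t x y assume t: "(0::real) < t" "t < 1"
  have "a \<bullet> ((1 - t) *\<^sub>R x + t *\<^sub>R y) - b = (1 - t) *\<^sub>R (a \<bullet> x - b) + t *\<^sub>R (a \<bullet> y - b)"
    by (simp add: algebra_simps inner_add_right)
  then show "f (a \<bullet> ((1 - t) *\<^sub>R x + t *\<^sub>R y) - b) \<le> (1 - t) * f (a \<bullet> x - b) + t * f (a \<bullet> y - b)"
    using convex_onD[OF assms, of t "a \<bullet> x - b" "a \<bullet> y - b"] t by simp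
qed simp

lemma convex_on_sum':
  assumes "finite S" "\<And>i. i \<in> S \<Longrightarrow> convex_on UNIV (f i)"
  shows "convex_on UNIV (\<lambda>x. \<Sum>i\<in>S. f i x)"
  using assms by (induction S) (auto simp: convex_on_const intro!: convex_on_add)

text \<open>Every point of the compact level set \<open>{F = k}\<close> is cut off from \<open>{F \<le> E}\<close> by an open
  half-space, and finitely many of these cover the level set.\<close>
lemma (in quadratic_gauge) finite_polar_separation:
  assumes E: "0 < E" and k: "E < k"
  obtains S where "finite S" "\<And>a x. a \<in> S \<Longrightarrow> F x \<le> E \<Longrightarrow> a \<bullet> x \<le> 1"
    "\<And>x. F x = k \<Longrightarrow> \<exists>a\<in>S. 1 < a \<bullet> x"
proof -
  define K where "K = {x. F x = k}"
  have "closed K" unfolding K_def by (rule closed_Collect_eq[OF continuous]) simp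
  then have "compact ({x. F x \<le> k} \<inter> K)" by (rule compact_Int_closed[OF compact_sublevel])
  then have cK: "compact K" by (simp add: K_def Int_absorb1 Collect_mono)
  have sep: "\<exists>a. (\<forall>x. F x \<le> E \<longrightarrow> a \<bullet> x \<le> 1) \<and> 1 < a \<bullet> z" if "z \<in> K" for z
  proof -
    have "z \<notin> {x. F x \<le> E}" using that k by (simp add: K_def)
    then have "\<exists>a b. a \<bullet> z < b \<and> (\<forall>x\<in>{x. F x \<le> E}. b < a \<bullet> x)"
      by (intro separating_hyperplane_closed_point convex_sublevel
          compact_imp_closed compact_sublevel)
    then obtain a b where ab: "a \<bullet> z < b" "\<And>x. F x \<le> E \<Longrightarrow> b < a \<bullet> x" by auto
    have "b < 0" using ab(2)[of 0] E by simp
    then show ?thesis using ab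
      by (intro exI[of _ "(1 / b) *\<^sub>R a"]) (force simp: field_simps)
  qed
  define A where "A = {a. \<forall>x. F x \<le> E \<longrightarrow> a \<bullet> x \<le> 1}"
  have "K \<subseteq> (\<Union>a\<in>A. {x. 1 < a \<bullet> x})" using sep by (force simp: A_def)
  moreover have "open {x. 1 < a \<bullet> x}" for a :: 'a
    by (intro open_Collect_less continuous_intros)
  ultimately obtain S where "S \<subseteq> A" "finite S" "K \<subseteq> (\<Union>a\<in>S. {x. 1 < a \<bullet> x})"
    using compactE_image[OF cK, of A "\<lambda>a. {x. 1 < a \<bullet> x}"] by metis
  then show thesis by (intro that[of S]) (auto simp: A_def K_def)
qed

text \<open>The body is \<open>{G \<le> E}\<close> for \<open>G = c + \<kappa> g\<close>, where \<open>c\<close> is the given sum of squares and \<open>g\<close> adds one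
  barrier for each separating half-space.  Since \<open>g\<close> vanishes on \<open>{F \<le> E}\<close>, this set stays inside,
  and since \<open>g \<ge> 0\<close>, the body stays inside \<open>{c \<le> E}\<close>: points of \<open>{F \<le> E}\<close> at which \<open>c = E\<close> remain
  on the boundary.  A large \<open>\<kappa>\<close> makes \<open>G > E\<close> on the level set \<open>{F = k}\<close>, and by convexity beyond it.\<close>
lemma (in quadratic_gauge) smooth_outer_approximation:
  assumes E: "0 < E" and k: "E < k" and fin: "finite J"
    and c: "\<And>x. (\<Sum>b\<in>J. (b \<bullet> x)\<^sup>2) \<le> F x"
  obtains Y where "smooth_convex_body Y" "{x. F x \<le> E} \<subseteq> Y" "Y \<subseteq> {x. F x \<le> k}"
    "Y \<subseteq> {x. (\<Sum>b\<in>J. (b \<bullet> x)\<^sup>2) \<le> E}"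
proof -
  obtain S where S: "finite S" "\<And>a x. a \<in> S \<Longrightarrow> F x \<le> E \<Longrightarrow> a \<bullet> x \<le> 1"
    "\<And>x. F x = k \<Longrightarrow> \<exists>a\<in>S. 1 < a \<bullet> x"
    using finite_polar_separation[OF E k] by metis
  define g where "g x = (\<Sum>a\<in>S. 1 * barrier (a \<bullet> x - 1))" for x
  have g_nonneg: "0 \<le> g x" for x by (simp add: g_def sum_nonneg barrier_nonneg)
  have smooth_g: "smooth_fun g" unfolding g_def
    by (intro smooth_fun_sum smooth_fun_ridge smooth_real_barrier)
  have g_pos: "0 < g x" if "F x = k" for x
  proof -
    obtain a where "a \<in> S" "1 < a \<bullet> x" using S(3) \<open>F x = k\<close> by blast
    then show ?thesis unfolding g_def using S(1)
      by (intro sum_pos2[of _ a]) (auto simp: barrier_pos barrier_nonneg)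
  qed
  have "closed {x. F x = k}" by (rule closed_Collect_eq[OF continuous]) simp
  then have "compact ({x. F x \<le> k} \<inter> {x. F x = k})"
    by (rule compact_Int_closed[OF compact_sublevel])
  then have cK: "compact {x. F x = k}" by (simp add: Int_absorb1 Collect_mono)
  obtain m where m: "0 < m" "\<And>x. F x = k \<Longrightarrow> m \<le> g x"
  proof (cases "{x. F x = k} = {}")
    case True
    then show thesis using that[of 1] by auto
  next
    case False
    then obtain x0 where "F x0 = k" "\<And>x. F x = k \<Longrightarrow> g x0 \<le> g x"
      using continuous_attains_inf[OF cK False continuous_on_subset[OF smooth_fun_continuous[OF smooth_g]]]
      by auto
    then show thesis using that[of "g x0"] g_pos by auto
  qed
  \<comment> \<open>twice the factor that lifts \<open>g\<close> to \<open>E\<close> on the level set, so that \<open>G\<close> exceeds \<open>E\<close> strictly\<close>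
  define \<kappa> where "\<kappa> = 2 * E / m"
  have \<kappa>: "0 < \<kappa>" using m E by (simp add: \<kappa>_def)
  define G where "G x = (\<Sum>b\<in>J. 1 * (b \<bullet> x - 0)\<^sup>2) + (\<Sum>a\<in>S. \<kappa> * barrier (a \<bullet> x - 1))" for x
  have G_eq: "G x = (\<Sum>b\<in>J. (b \<bullet> x)\<^sup>2) + \<kappa> * g x" for x
    by (simp add: G_def g_def sum_distrib_left)
  have smooth: "smooth_fun G" unfolding G_def
    by (intro smooth_fun_add smooth_fun_sum smooth_fun_ridge[OF smooth_real_square]
        smooth_fun_ridge[OF smooth_real_barrier])
  have convex_sq: "convex_on UNIV (\<lambda>x::real. x\<^sup>2)" by (rule convex_power_even) simp
  have convexG: "convex_on UNIV G" unfolding G_def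
    using \<kappa> by (intro convex_on_add convex_on_sum' convex_on_cmul convex_on_ridge[OF convex_barrier]
        convex_on_ridge[OF convex_sq] fin S) auto
  have G0: "G 0 = 0" by (simp add: G_def)
  have sub: "F x \<le> k" if "G x \<le> E" for x
  proof (rule ccontr)
    assume "\<not> F x \<le> k"
    \<comment> \<open>the factor that moves \<open>x\<close> back to the level set \<open>F = k\<close>\<close>
    define t where "t = sqrt (k / F x)"
    have Fx: "k < F x" "0 < F x" using \<open>\<not> F x \<le> k\<close> k E by auto
    have t: "0 \<le> t" "t \<le> 1" using Fx k E by (auto simp: t_def)
    have "F (t *\<^sub>R x) = k" using Fx k E by (simp add: scale t_def)
    then have "2 * E \<le> \<kappa> * g (t *\<^sub>R x)"
      using m(2)[of "t *\<^sub>R x"] m(1) E by (simp add: \<kappa>_def field_simps)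
    also have "\<dots> \<le> G (t *\<^sub>R x)" by (simp add: G_eq sum_nonneg)
    also have "\<dots> \<le> t * G x"
      using convex_onD[OF convexG t, of 0 x] by (simp add: G0)
    also have "\<dots> \<le> 1 * E"
      using that t E by (intro order_trans[OF mult_left_mono[OF that t(1)] mult_right_mono]) auto
    finally show False using E by simp
  qed
  show thesis
  proof (rule that[of "{x. G x \<le> E}"])
    have "bounded {x. G x \<le> E}"
      by (rule bounded_subset[OF compact_imp_bounded[OF compact_sublevel[of k]]]) (use sub in auto)
    then show "smooth_convex_body {x. G x \<le> E}"
      using smooth_convex_body_sublevel[OF smooth convexG] G0 E by simp
    show "{x. F x \<le> E} \<subseteq> {x. G x \<le> E}"
      using c order_trans by (fastforce simp: G_def S(2))
    show "{x. G x \<le> E} \<subseteq> {x. F x \<le> k}" using sub by blast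
    show "{x. G x \<le> E} \<subseteq> {x. (\<Sum>b\<in>J. (b \<bullet> x)\<^sup>2) \<le> E}"
    proof
      fix x assume "x \<in> {x. G x \<le> E}"
      moreover have "0 \<le> \<kappa> * g x" using \<kappa> g_nonneg by simp
      ultimately show "x \<in> {x. (\<Sum>b\<in>J. (b \<bullet> x)\<^sup>2) \<le> E}" unfolding G_eq by simp
    qed
  qed
qed

text \<open>The set \<open>{F \<le> s\<^sup>2 E}\<close> is the dilate of \<open>{F \<le> E}\<close> by \<open>s\<close>, so bodies between the two are within
  distance \<open>(s - 1) R\<close> of \<open>{F \<le> E}\<close>, where \<open>R\<close> bounds its norm.\<close>
lemma (in quadratic_gauge) smooth_bodies_nearby:
  assumes E: "0 < E" and fin: "finite J"
    and c: "\<And>x. (\<Sum>b\<in>J. (b \<bullet> x)\<^sup>2) \<le> F x" and e: "0 < e"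
  obtains Y where "smooth_convex_body Y" "{x. F x \<le> E} \<subseteq> Y"
    "Y \<subseteq> {x. (\<Sum>b\<in>J. (b \<bullet> x)\<^sup>2) \<le> E}" "hausdorff_dist Y {x. F x \<le> E} < e"
proof -
  define X where "X = {x. F x \<le> E}"
  have "bounded X" unfolding X_def by (rule compact_imp_bounded[OF compact_sublevel])
  then obtain R where R: "0 < R" "\<And>x. x \<in> X \<Longrightarrow> norm x \<le> R"
    using bounded_pos by blast
  define s where "s = 1 + e / (2 * R)"
  have s: "1 < s" using R e by (simp add: s_def)
  have "E < s\<^sup>2 * E" using s E by simp
  then obtain Y where Y: "smooth_convex_body Y" "X \<subseteq> Y" "Y \<subseteq> {x. F x \<le> s\<^sup>2 * E}"
    "Y \<subseteq> {x. (\<Sum>b\<in>J. (b \<bullet> x)\<^sup>2) \<le> E}"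
    using smooth_outer_approximation[OF E _ fin c] unfolding X_def by metis
  have "0 \<in> X" using E by (simp add: X_def)
  have near: "infdist y X \<le> e / 2" if "y \<in> Y" for y
  proof -
    define x where "x = (1 / s) *\<^sub>R y"
    have "F x \<le> E" using Y(3) that s by (auto simp: x_def scale power_divide field_simps)
    then have x: "x \<in> X" by (simp add: X_def)
    have "y = s *\<^sub>R x" using s by (simp add: x_def)
    then have "y - x = (s - 1) *\<^sub>R x" by (simp add: scaleR_left_diff_distrib)
    then have "dist y x = (s - 1) * norm x" using s by (simp add: dist_norm)
    also have "\<dots> \<le> (s - 1) * R" using s R x by (intro mult_left_mono) auto
    also have "\<dots> = e / 2" using R by (simp add: s_def)
    finally show ?thesis using infdist_le2[OF x] by blast
  qed
  have "(SUP a\<in>Y. infdist a X) \<le> e / 2"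
    using Y(2) \<open>0 \<in> X\<close> near by (intro cSUP_least) auto
  moreover have "(SUP b\<in>X. infdist b Y) \<le> e / 2"
    using Y(2) \<open>0 \<in> X\<close> e by (intro cSUP_least) (auto simp: subset_iff)
  ultimately have "hausdorff_dist Y X < e" using e by (simp add: hausdorff_dist_def)
  then show thesis using that Y unfolding X_def by blast
qed

section \<open>Positive definite forms and the volume of an ellipsoid\<close>

text \<open>Gram--Schmidt for the inner product of \<open>A\<close>: as long as the set is too small to span the space,
  some vector outside the span can be orthogonalized and normalized.\<close>
lemma quadratic_form_orthonormal_set:
  fixes A :: "real ^ 'n ^ 'n"
  assumes sym: "transpose A = A" and pos: "\<And>x. x \<noteq> 0 \<Longrightarrow> 0 < x \<bullet> (A *v x)"
    and "k \<le> CARD('n)"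
  shows "\<exists>S. finite S \<and> card S = k \<and>
    (\<forall>x\<in>S. \<forall>y\<in>S. x \<bullet> (A *v y) = (if x = y then 1 else 0))"
  using assms(3)
proof (induction k)
  case 0
  show ?case by (intro exI[of _ "{}"]) simp
next
  case (Suc k)
  then obtain S where S: "finite S" "card S = k"
    "\<And>x y. x \<in> S \<Longrightarrow> y \<in> S \<Longrightarrow> x \<bullet> (A *v y) = (if x = y then 1 else 0)"
    by auto
  have symD: "x \<bullet> (A *v y) = y \<bullet> (A *v x)" for x y
    by (metis dot_lmul_matrix inner_commute sym transpose_matrix_vector)
  have "dim (span S) < CARD('n)"
    using dim_le_card'[OF S(1)] S(2) Suc(2) by simp
  then have "span S \<noteq> UNIV" by (metis dim_UNIV nat_neq_iff DIM_cart DIM_real mult.right_neutral)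
  then obtain x where x: "x \<notin> span S" by blast
  define y where "y = x - (\<Sum>e\<in>S. (e \<bullet> (A *v x)) *\<^sub>R e)"
  have "y \<noteq> 0"
  proof
    assume "y = 0"
    then have "x = (\<Sum>e\<in>S. (e \<bullet> (A *v x)) *\<^sub>R e)" by (simp add: y_def)
    also have "\<dots> \<in> span S" by (intro span_sum span_mul span_base)
    finally show False using x by simp
  qed
  have orth: "e \<bullet> (A *v y) = 0" if "e \<in> S" for e
  proof -
    have "e \<bullet> (A *v (\<Sum>e'\<in>S. (e' \<bullet> (A *v x)) *\<^sub>R e'))
        = (\<Sum>e'\<in>S. (e' \<bullet> (A *v x)) * (e \<bullet> (A *v e')))"
      by (simp add: linear_sum[OF matrix_vector_mul_linear] inner_sum_right
          matrix_vector_mult_scaleR)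
    also have "\<dots> = (\<Sum>e'\<in>S. if e' = e then e \<bullet> (A *v x) else 0)"
      using that by (intro sum.cong) (auto simp: S(3))
    also have "\<dots> = e \<bullet> (A *v x)" using S(1) that by simp
    finally show ?thesis by (simp add: y_def matrix_vector_mult_diff_distrib inner_diff_right)
  qed
  define r where "r = sqrt (y \<bullet> (A *v y))"
  have r: "0 < r" "y \<bullet> (A *v y) = r\<^sup>2" using pos[OF \<open>y \<noteq> 0\<close>] by (auto simp: r_def)
  define z where "z = (1 / r) *\<^sub>R y"
  have "z \<bullet> (A *v z) = (y \<bullet> (A *v y)) / r\<^sup>2"
    by (simp add: z_def matrix_vector_mult_scaleR power2_eq_square)
  then have zz: "z \<bullet> (A *v z) = 1" using r by simp
  have ez: "e \<bullet> (A *v z) = 0" if "e \<in> S" for e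
    using orth[OF that] by (simp add: z_def matrix_vector_mult_scaleR)
  have ze: "z \<bullet> (A *v e) = 0" if "e \<in> S" for e
    using ez[OF that] symD by simp
  have "z \<notin> S" using zz ez by force
  then show ?case
    using S zz ez ze by (intro exI[of _ "insert z S"]) auto
qed

lemma quadratic_form_normalization:
  fixes Q :: "real ^ 'n \<Rightarrow> real"
  assumes "positive_definite_quadratic_form Q"
  obtains N :: "real ^ 'n ^ 'n" where "invertible N" "\<And>v. Q (N *v v) = v \<bullet> v"
proof -
  obtain A :: "real ^ 'n ^ 'n" where A: "transpose A = A" "\<And>x. Q x = x \<bullet> (A *v x)"
    and pos: "\<And>x. x \<noteq> 0 \<Longrightarrow> 0 < Q x"
    using assms unfolding positive_definite_quadratic_form_def by blast
  obtain S where S: "finite S" "card S = CARD('n)"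
    "\<And>x y. x \<in> S \<Longrightarrow> y \<in> S \<Longrightarrow> x \<bullet> (A *v y) = (if x = y then 1 else 0)"
    using quadratic_form_orthonormal_set[OF A(1), of "CARD('n)"] pos A(2) by auto
  obtain h :: "'n \<Rightarrow> real ^ 'n" where h: "bij_betw h UNIV S"
    using S finite_same_card_bij[of "UNIV :: 'n set" S] by auto
  define N :: "real ^ 'n ^ 'n" where "N = (\<chi> i j. h j $ i)"
  have N: "N *v v = (\<Sum>j\<in>UNIV. v $ j *\<^sub>R h j)" for v
    by (simp add: vec_eq_iff N_def matrix_vector_mult_def mult.commute)
  have orth: "h i \<bullet> (A *v h j) = (if i = j then 1 else 0)" for i j
    using S(3)[of "h i" "h j"] h by (auto simp: bij_betw_def inj_eq)
  have QN: "Q (N *v v) = v \<bullet> v" for v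
  proof -
    have "Q (N *v v) = (\<Sum>j\<in>UNIV. \<Sum>i\<in>UNIV. v $ j * (v $ i * (h i \<bullet> (A *v h j))))"
      by (simp add: A(2) N linear_sum[OF matrix_vector_mul_linear] inner_sum_right inner_sum_left
          matrix_vector_mult_scaleR sum_distrib_left)
    also have "\<dots> = (\<Sum>j\<in>UNIV. \<Sum>i\<in>UNIV. if i = j then v $ j * v $ j else 0)"
      by (intro sum.cong) (auto simp: orth)
    also have "\<dots> = v \<bullet> v" by (simp add: inner_vec_def)
    finally show ?thesis .
  qed
  have "inj ((*v) N)"
  proof (subst linear_injective_0[OF matrix_vector_mul_linear], intro allI impI)
    fix v assume "N *v v = 0"
    then have "v \<bullet> v = Q 0" using QN[of v] by simp
    also have "\<dots> = 0" by (simp add: A(2))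
    finally show "v = 0" by simp
  qed
  then have "invertible N"
    by (simp add: invertible_left_inverse matrix_left_invertible_injective)
  then show thesis using QN by (rule that)
qed

text \<open>Phase space is a product and not a coordinate space; identifying its basis with an index type
  carries Lebesgue measure to coordinates, where determinants describe how linear maps change
  volume.\<close>
lemma emeasure_lborel_basis_change:
  fixes h :: "'m::finite \<Rightarrow> 'a::euclidean_space"
  assumes h: "bij_betw h UNIV Basis" and S: "S \<in> sets borel"
  shows "emeasure lborel {x. (\<chi> i. x \<bullet> h i) \<in> S} = emeasure lborel S"
proof -
  define \<iota> :: "'a \<Rightarrow> real ^ 'm" where "\<iota> x = (\<chi> i. x \<bullet> h i)" for x
  have meas: "\<iota> \<in> borel_measurable borel"
    unfolding \<iota>_def
    by (rule borel_measurable_continuous_onI, rule continuous_on_vec_lambda)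
       (rule continuous_on_inner[OF continuous_on_id continuous_on_const])
  have "lborel = distr lborel borel \<iota>"
  proof (rule lborel_eqI)
    fix l u :: "real ^ 'm" assume le: "\<And>b. b \<in> Basis \<Longrightarrow> l \<bullet> b \<le> u \<bullet> b"
    define l' u' where "l' = (\<Sum>i\<in>UNIV. l $ i *\<^sub>R h i)" and "u' = (\<Sum>i\<in>UNIV. u $ i *\<^sub>R h i)"
    have hB: "h i \<in> Basis" for i using bij_betwE[OF h] by simp
    have hh: "h i \<bullet> h j = (if i = j then 1 else 0)" for i j
      by (simp add: inner_Basis hB inj_eq[OF bij_betw_imp_inj_on[OF h]])
    have coord: "l' \<bullet> h i = l $ i" "u' \<bullet> h i = u $ i" for i
      by (simp_all add: l'_def u'_def inner_sum_left hh if_distrib cong: if_cong)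
    have ball: "(\<forall>b\<in>Basis. P b) \<longleftrightarrow> (\<forall>i. P (h i))" for P
      using bij_betw_imp_surj_on[OF h] by (metis hB imageE)
    have le': "\<forall>b\<in>Basis. l' \<bullet> b \<le> u' \<bullet> b"
    proof -
      have "l $ i \<le> u $ i" for i using le[of "axis i 1"] by (simp add: axis_in_Basis_iff inner_axis)
      then show ?thesis unfolding ball by (simp add: coord)
    qed
    have "\<iota> -` box l u = box l' u'"
      by (intro set_eqI) (simp add: mem_box_cart mem_box(1)[where 'a='a] ball coord \<iota>_def)
    then have "emeasure (distr lborel borel \<iota>) (box l u) = emeasure lborel (box l' u')"
      using meas by (subst emeasure_distr) auto
    also have "\<dots> = (\<Prod>b\<in>Basis. (u' - l') \<bullet> b)"
      using le' by (subst emeasure_lborel_box) auto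
    also have "(\<Prod>b\<in>Basis. (u' - l') \<bullet> b) = (\<Prod>i\<in>UNIV. (u - l) $ i)"
      using prod.reindex_bij_betw[OF h, of "\<lambda>b. (u' - l') \<bullet> b"] by (simp add: inner_diff_left coord)
    also have "\<dots> = (\<Prod>b\<in>Basis. (u - l) \<bullet> b)"
    proof -
      have "bij_betw (\<lambda>i :: 'm. axis i (1 :: real)) UNIV Basis"
        by (auto simp: bij_betw_def inj_on_def axis_eq_axis Basis_vec_def)
      from prod.reindex_bij_betw[OF this, of "\<lambda>b. (u - l) \<bullet> b"]
      show ?thesis by (simp add: inner_axis)
    qed
    finally show "emeasure (distr lborel borel \<iota>) (box l u) = (\<Prod>b\<in>Basis. (u - l) \<bullet> b)" .
  qed simp
  then have "emeasure lborel S = emeasure (distr lborel borel \<iota>) S" by simp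
  also have "\<dots> = emeasure lborel (\<iota> -` S)" using meas S by (subst emeasure_distr) auto
  finally show ?thesis by (simp add: \<iota>_def vimage_def)
qed

text \<open>In coordinates a symplectic matrix \<open>A\<close> satisfies \<open>A\<^sup>T B A = B\<close> for the invertible matrix \<open>B\<close> of
  the symplectic form, whence \<open>(det A)\<^sup>2 = 1\<close>.\<close>
lemma symplectic_measure_preserving:
  fixes L :: "'n::finite phase \<Rightarrow> 'n phase"
  assumes L: "linear L" and symplectic: "\<And>x y. omega (L x) (L y) = omega x y" and K: "compact K"
  shows "measure lborel (L ` K) = measure lborel K"
proof -
  have "card (Basis :: 'n phase set) = CARD('n bit0)" by simp
  \<comment> \<open>the index type \<open>'n bit0\<close> has exactly \<open>2 n\<close> elements\<close>
  then obtain h :: "'n bit0 \<Rightarrow> 'n phase" where h: "bij_betw h UNIV Basis"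
    using finite_same_card_bij[of "UNIV :: 'n bit0 set" "Basis :: 'n phase set"] by auto
  have hB: "h i \<in> Basis" for i using bij_betwE[OF h] by simp
  have hh: "h i \<bullet> h j = (if i = j then 1 else 0)" for i j
    by (simp add: inner_Basis hB inj_eq[OF bij_betw_imp_inj_on[OF h]])
  define \<iota> :: "'n phase \<Rightarrow> real ^ 'n bit0" where "\<iota> x = (\<chi> i. x \<bullet> h i)" for x
  define \<rho> :: "real ^ 'n bit0 \<Rightarrow> 'n phase" where "\<rho> x = (\<Sum>i\<in>UNIV. x $ i *\<^sub>R h i)" for x
  have lin: "linear \<iota>" "linear \<rho>"
    by (intro linearI; simp add: \<iota>_def vec_eq_iff inner_add_left)
       (intro linearI; simp add: \<rho>_def scaleR_left_distrib sum.distrib scaleR_sum_right)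
  have \<iota>\<rho>: "\<iota> (\<rho> x) = x" for x
    by (simp add: \<iota>_def \<rho>_def vec_eq_iff inner_sum_left hh if_distrib cong: if_cong)
  have \<rho>\<iota>: "\<rho> (\<iota> x) = x" for x
    using sum.reindex_bij_betw[OF h, of "\<lambda>b. (x \<bullet> b) *\<^sub>R b"]
    by (simp add: \<iota>_def \<rho>_def euclidean_representation)
  have \<iota>_inner: "\<iota> x \<bullet> y = x \<bullet> \<rho> y" for x y
    by (simp add: \<iota>_def \<rho>_def inner_vec_def inner_sum_right mult.commute)
  define J :: "'n phase \<Rightarrow> 'n phase" where "J z = (snd z, - fst z)" for z
  have linJ: "linear J" by (rule linearI) (simp_all add: J_def)
  have omegaJ: "omega x y = x \<bullet> J y" for x y
    by (simp add: omega_def J_def inner_prod_def inner_vec_def sum_subtractf inner_commute mult.commute sum_negf)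
  define A where "A = matrix (\<iota> \<circ> L \<circ> \<rho>)"
  define B where "B = matrix (\<iota> \<circ> J \<circ> \<rho>)"
  have A: "A *v x = \<iota> (L (\<rho> x))" and B: "B *v x = \<iota> (J (\<rho> x))" for x
    using fun_cong[OF matrix_vector_mul(2)[OF linear_compose[OF lin(2) linear_compose[OF L lin(1)]]]]
      fun_cong[OF matrix_vector_mul(2)[OF linear_compose[OF lin(2) linear_compose[OF linJ lin(1)]]]]
    by (simp_all add: A_def B_def o_def)
  have form: "x \<bullet> (B *v y) = omega (\<rho> x) (\<rho> y)" for x y
    unfolding B omegaJ by (metis \<iota>_inner inner_commute)
  have "x \<bullet> ((transpose A ** B ** A) *v y) = x \<bullet> (B *v y)" for x y
  proof -
    have "x \<bullet> ((transpose A ** B ** A) *v y) = (A *v x) \<bullet> (B *v (A *v y))"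
      by (metis dot_lmul_matrix inner_commute matrix_vector_mul_assoc transpose_matrix_vector)
    then show ?thesis by (simp add: form A \<rho>\<iota> symplectic)
  qed
  then have "transpose A ** B ** A = B" by (metis matrix_eq vector_eq_ldot)
  then have "det A * det B * det A = det B" by (metis det_mul det_transpose)
  moreover have "det B \<noteq> 0"
  proof -
    define B' where "B' = matrix (\<lambda>x. - (B *v x))"
    have B': "B' *v x = - (B *v x)" for x
      unfolding B'_def
      by (rule fun_cong[OF matrix_vector_mul(2)]) (intro linear_compose_neg matrix_vector_mul_linear)
    have "B' ** B = mat 1"
    proof -
      have "(B' ** B) *v x = mat 1 *v x" for x
      proof -
        have "J (J (\<rho> x)) = - \<rho> x" by (simp add: J_def prod_eq_iff)
        then show ?thesis
          by (simp add: matrix_vector_mul_assoc[symmetric] B' B \<rho>\<iota> linear_neg[OF lin(1)] \<iota>\<rho>)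
      qed
      then show ?thesis by (simp add: matrix_eq)
    qed
    then show ?thesis by (metis det_I det_mul mult_zero_right zero_neq_one)
  qed
  ultimately have "(det A)\<^sup>2 = 1" by (simp add: power2_eq_square)
  then have det: "\<bar>det A\<bar> = 1" using power2_eq_1_iff[of "det A"] by auto
  have compact: "compact (f ` S)" if "linear f" "compact S" for f :: "'c::euclidean_space \<Rightarrow> 'd::euclidean_space" and S
    using that by (intro compact_continuous_image linear_continuous_on) (simp_all add: linear_conv_bounded_linear)
  have iso: "measure lebesgue (\<iota> ` S) = measure lborel S" if "compact S" for S
  proof -
    have "{x. (\<chi> i. x \<bullet> h i) \<in> \<iota> ` S} = S" using \<rho>\<iota> by (auto simp: \<iota>_def[symmetric]) (metis \<rho>\<iota>)
    moreover have "\<iota> ` S \<in> sets borel" using compact[OF lin(1) that] by (simp add: borel_compact)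
    ultimately have "emeasure lborel S = emeasure lborel (\<iota> ` S)"
      using emeasure_lborel_basis_change[OF h, of "\<iota> ` S"] by simp
    then show ?thesis using \<open>\<iota> ` S \<in> sets borel\<close> by (simp add: measure_def)
  qed
  have "measure lborel (L ` K) = measure lebesgue (\<iota> ` L ` K)"
    using iso[OF compact[OF L K]] by simp
  also have "\<iota> ` L ` K = (*v) A ` (\<iota> ` K)" by (simp add: image_image A \<rho>\<iota>)
  also have "measure lebesgue \<dots> = \<bar>det A\<bar> * measure lebesgue (\<iota> ` K)"
    using measure_linear_image[OF matrix_vector_mul_linear lmeasurable_compact[OF compact[OF lin(1) K]]]
    by simp
  finally show ?thesis by (simp add: det iso[OF K])
qed

lemma measure_symplectic_image_cball:
  fixes L :: "'n::finite phase \<Rightarrow> 'n phase"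
  assumes "linear L" "\<And>x y. omega (L x) (L y) = omega x y" "0 \<le> r"
  shows "measure lborel (L ` cball 0 r) = (pi * r\<^sup>2) ^ CARD('n) / fact CARD('n)"
proof -
  have dim: "DIM('n phase) = 2 * CARD('n)" by simp
  have "measure lborel (L ` cball 0 r) = measure lborel (cball (0 :: 'n phase) r)"
    by (rule symplectic_measure_preserving[OF assms(1,2) compact_cball])
  also have "\<dots> = pi ^ CARD('n) / fact CARD('n) * r ^ (2 * CARD('n))"
    unfolding content_cball[OF assms(3)] dim unit_ball_vol_even ..
  also have "\<dots> = (pi * r\<^sup>2) ^ CARD('n) / fact CARD('n)"
    by (simp add: power_mult_distrib power_mult)
  finally show ?thesis .
qed

section \<open>Closed characteristics and their action\<close>

lemma omega_inner: "omega u v = fst u \<bullet> snd v - fst v \<bullet> snd u"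
  by (simp add: omega_def inner_vec_def sum_subtractf)

lemma omega_skew: "omega u v = - omega v u"
  by (simp add: omega_inner)

lemma omega_self [simp]: "omega u u = 0"
  by (simp add: omega_inner)

lemma omega_linear [simp]:
  "omega (u + u') v = omega u v + omega u' v" "omega u (v + v') = omega u v + omega u v'"
  "omega (u - u') v = omega u v - omega u' v" "omega u (v - v') = omega u v - omega u v'"
  "omega (t *\<^sub>R u) v = t * omega u v" "omega u (t *\<^sub>R v) = t * omega u v"
  "omega (- u) v = - omega u v"
  by (simp_all add: omega_inner algebra_simps)

text \<open>Testing against \<open>(- snd d, fst d)\<close> gives the squared norm of \<open>d\<close>.\<close>
lemma omega_nondegenerate:
  assumes "\<And>w. omega u w = omega v w"
  shows "u = v"
proof -
  define d where "d = u - v"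
  have "omega d (- snd d, fst d) = 0" using assms by (simp add: d_def)
  then have "fst d \<bullet> fst d + snd d \<bullet> snd d = 0" by (simp add: omega_inner)
  then have "d = 0" by (simp add: add_nonneg_eq_0_iff prod_eq_iff)
  then show ?thesis by (simp add: d_def)
qed

lemma omega_hamiltonian_field:
  assumes "H differentiable at x"
  shows "omega (hamiltonian_field H x) w = - frechet_derivative H (at x) w"
proof -
  define d where "d = frechet_derivative H (at x)"
  have lin: "linear d" unfolding d_def by (rule linear_frechet_derivative[OF assms])
  have "w = (\<Sum>i\<in>UNIV. (fst w $ i) *\<^sub>R (axis i 1, 0)) + (\<Sum>i\<in>UNIV. (snd w $ i) *\<^sub>R (0, axis i 1))"
    by (simp add: prod_eq_iff fst_sum snd_sum basis_expansion scalar_mult_eq_scaleR[symmetric])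
  then have "d w = d (\<dots>)" by simp
  also have "\<dots> = (\<Sum>i\<in>UNIV. fst w $ i * d (axis i 1, 0)) + (\<Sum>i\<in>UNIV. snd w $ i * d (0, axis i 1))"
    by (simp only: linear_add[OF lin] linear_sum[OF lin] linear_scale[OF lin] real_scaleR_def)
  finally show ?thesis
    by (simp add: omega_def hamiltonian_field_def d_def[symmetric] sum_subtractf sum_negf mult.commute)
qed

text \<open>A vector of the characteristic line is \<open>omega\<close>-orthogonal to the kernel of the derivative of \<open>H\<close>.
  Its contraction with \<open>omega\<close> is then a multiple of that derivative, as is the contraction
  of the Hamiltonian vector.\<close>
lemma characteristic_line_hamiltonian:
  assumes diff: "H differentiable at x" and nz: "frechet_derivative H (at x) w0 \<noteq> 0"
    and v: "v \<in> characteristic_line H x"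
  obtains l where "v = l *\<^sub>R hamiltonian_field H x"
proof -
  define d where "d = frechet_derivative H (at x)"
  have lin: "linear d" unfolding d_def by (rule linear_frechet_derivative[OF diff])
  have d0: "d w0 \<noteq> 0" using nz by (simp add: d_def)
  define l where "l = - omega v w0 / d w0"
  have "omega v w = omega (l *\<^sub>R hamiltonian_field H x) w" for w
  proof -
    have "d (w - (d w / d w0) *\<^sub>R w0) = 0"
      using d0 by (simp add: linear_diff[OF lin] linear_scale[OF lin])
    then have "w - (d w / d w0) *\<^sub>R w0 \<in> tangent_hyperplane H x"
      unfolding tangent_hyperplane_def d_def by blast
    then have "omega v (w - (d w / d w0) *\<^sub>R w0) = 0"
      using v unfolding characteristic_line_def by blast
    then have "omega v w = d w / d w0 * omega v w0" by simp
    then show ?thesis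
      by (simp add: omega_hamiltonian_field[OF diff] d_def[symmetric] l_def)
  qed
  then show thesis using that omega_nondegenerate by blast
qed

lemma defining_function_differentiable:
  "defining_function Y H \<Longrightarrow> H differentiable at x"
  unfolding defining_function_def using smooth_fun_differentiable by blast

text \<open>If the derivative were negative, moving from \<open>x\<close> towards \<open>z\<close> would increase \<open>H\<close> above zero and
  leave \<open>Y\<close>.\<close>
lemma outward_derivative_nonneg:
  assumes "convex Y" and Y: "defining_function Y H" and x: "x \<in> Y" "H x = 0" and z: "z \<in> Y"
  shows "0 \<le> frechet_derivative H (at x) (x - z)"
proof (rule ccontr)
  assume "\<not> ?thesis"
  moreover have "linear (frechet_derivative H (at x))"
    by (rule linear_frechet_derivative[OF defining_function_differentiable[OF Y]])
  ultimately have "0 < frechet_derivative H (at x) (z - x)"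
    using linear_diff[of "frechet_derivative H (at x)" x z] linear_diff[of "frechet_derivative H (at x)" z x] by simp
  then obtain e where e: "0 < e" "\<And>h. 0 < h \<Longrightarrow> h < e \<Longrightarrow> H (x + 0 *\<^sub>R (z - x)) < H (x + (0 + h) *\<^sub>R (z - x))"
    using DERIV_pos_inc_right[OF directional_derivative[OF defining_function_differentiable[OF Y]]]
    by blast
  define h where "h = min 1 (e / 2)"
  have h: "0 < h" "h < e" "h \<le> 1" using e by (auto simp: h_def)
  have "(1 - h) *\<^sub>R x + h *\<^sub>R z \<in> Y" using convexD_alt[OF assms(1) x(1) z] h by simp
  then have "x + h *\<^sub>R (z - x) \<in> Y" by (simp add: algebra_simps)
  then show False using e(2)[OF h(1,2)] x(2) Y by (simp add: defining_function_def)
qed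

text \<open>The outer normal at a smooth boundary point is unique.  Directions along which \<open>H\<close>
  decreases enter \<open>Y\<close>, so \<open>l\<close> is nonpositive on the open half-space where the derivative of \<open>H\<close>
  is negative; two functionals related in this way are positively proportional.\<close>
lemma supporting_functional_derivative:
  fixes l :: "'a::euclidean_space \<Rightarrow> real"
  assumes Y: "defining_function Y H" and z: "z \<in> Y" and l: "linear l" "l w1 \<noteq> 0"
    and sup: "\<And>w. w \<in> Y \<Longrightarrow> l w \<le> l z"
  shows "H z = 0" "\<exists>k>0. \<forall>w. l w = k * frechet_derivative H (at z) w"
proof -
  define d where "d = frechet_derivative H (at z)"
  have diff: "H differentiable at z" by (rule defining_function_differentiable[OF Y])
  have lin: "linear d" unfolding d_def by (rule linear_frechet_derivative[OF diff])
  have Yeq: "w \<in> Y \<longleftrightarrow> H w \<le> 0" for w using Y by (auto simp: defining_function_def)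
  show Hz: "H z = 0"
  proof (rule ccontr)
    assume "H z \<noteq> 0"
    then have "H z < 0" using z Yeq by force
    define w where "w = l w1 *\<^sub>R w1"
    have "l w = (l w1)\<^sup>2"
      unfolding w_def by (simp only: linear_scale[OF l(1)] real_scaleR_def power2_eq_square)
    then have lw: "0 < l w" using l(2) by simp
    have "isCont (\<lambda>t. H (z + t *\<^sub>R w)) 0"
      by (rule DERIV_isCont[OF directional_derivative[OF diff]])
    then have "((\<lambda>t. H (z + t *\<^sub>R w)) \<longlongrightarrow> H z) (at 0)" by (simp add: isCont_def)
    then have "((\<lambda>t. H (z + t *\<^sub>R w)) \<longlongrightarrow> H z) (at_right 0)" by (simp add: filterlim_at_split)
    then have "\<forall>\<^sub>F t in at_right 0. H (z + t *\<^sub>R w) < 0"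
      by (rule order_tendstoD) fact
    then have "\<forall>\<^sub>F t in at_right 0. H (z + t *\<^sub>R w) < 0 \<and> 0 < t"
      by (simp add: eventually_conj_iff eventually_at_filter)
    then obtain t where "H (z + t *\<^sub>R w) < 0" "0 < t"
      using eventually_happens trivial_limit_at_right_real by blast
    then show False using sup[of "z + t *\<^sub>R w"] Yeq lw
      by (simp add: linear_add[OF l(1)] linear_scale[OF l(1)] mult_le_0_iff)
  qed
  have neg: "l w \<le> 0" if "d w < 0" for w
  proof -
    obtain e where e: "0 < e" "\<And>h. 0 < h \<Longrightarrow> h < e \<Longrightarrow> H (z + (0 + h) *\<^sub>R w) < H (z + 0 *\<^sub>R w)"
      using DERIV_neg_dec_right[OF directional_derivative[OF diff, of w]] \<open>d w < 0\<close>
      unfolding d_def by blast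
    have "z + (e / 2) *\<^sub>R w \<in> Y" using e(2)[of "e / 2"] e(1) Hz Yeq by simp
    then show ?thesis using sup e(1)
      by (force simp: linear_add[OF l(1)] linear_scale[OF l(1)] mult_le_0_iff)
  qed
  obtain w where w: "d w \<noteq> 0" using Y Hz unfolding defining_function_def d_def by blast
  \<comment> \<open>a strictly decreasing direction, whatever the sign of \<open>d w\<close>\<close>
  define w0 where "w0 = - d w *\<^sub>R w"
  have "d w0 = - (d w)\<^sup>2"
    unfolding w0_def by (simp only: linear_scale[OF lin] real_scaleR_def power2_eq_square mult_minus_left)
  then have w0: "d w0 < 0" using w by simp
  have ker: "l u = 0" if "d u = 0" for u
  proof (rule ccontr)
    assume nz: "l u \<noteq> 0"
    have "l (w0 + ((1 - l w0) / l u) *\<^sub>R u) \<le> 0"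
      by (rule neg) (simp add: linear_add[OF lin] linear_scale[OF lin] that w0)
    then show False using nz by (simp add: linear_add[OF l(1)] linear_scale[OF l(1)])
  qed
  define k where "k = l w0 / d w0"
  have eq: "l w = k * d w" for w
  proof -
    have "l (w - (d w / d w0) *\<^sub>R w0) = 0"
      using w0 by (intro ker) (simp add: linear_diff[OF lin] linear_scale[OF lin])
    then show ?thesis by (simp add: k_def linear_diff[OF l(1)] linear_scale[OF l(1)] field_simps)
  qed
  have "0 \<le> k" using neg[OF w0] w0 by (simp add: k_def divide_nonpos_neg)
  moreover have "k \<noteq> 0" using eq[of w1] l(2) by auto
  ultimately show "\<exists>k>0. \<forall>w. l w = k * frechet_derivative H (at z) w"
    using eq unfolding d_def by (intro exI[of _ k]) simp
qed

text \<open>Twice the action is the integral of \<open>omega (\<gamma> - z) \<gamma>'\<close> for any fixed \<open>z\<close>, because the two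
  integrands differ by an exact derivative.  If \<open>z\<close> lies in the body and \<open>\<gamma>' = l X\<^sub>H\<close> with \<open>l > 0\<close>,
  the integrand is \<open>l\<close> times the derivative of \<open>H\<close> in the outward direction \<open>\<gamma> - z\<close>.\<close>
lemma action_nonneg:
  assumes Y: "convex_body Y" and \<gamma>: "closed_characteristic Y \<gamma>"
  shows "0 \<le> action \<gamma>"
proof -
  obtain D where D: "\<And>t. t \<in> {0..1} \<Longrightarrow> (\<gamma> has_vector_derivative D t) (at t)"
    and contD: "continuous_on {0..1} D"
    using \<gamma> unfolding closed_characteristic_def C1_differentiable_on_def by blast
  have vd: "vector_derivative \<gamma> (at t) = D t" if "t \<in> {0..1}" for t
    using D[OF that] by (rule vector_derivative_at)
  have closed: "\<gamma> 1 = \<gamma> 0" using \<gamma> by (simp add: closed_characteristic_def pathfinish_def pathstart_def)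
  obtain H where H: "defining_function Y H"
    and char: "\<And>t. t \<in> {0..1} \<Longrightarrow> D t \<in> characteristic_line H (\<gamma> t) \<and> 0 < D t \<bullet> hamiltonian_field H (\<gamma> t)"
    using \<gamma> vd unfolding closed_characteristic_def Let_def by metis
  obtain z where z: "z \<in> Y" using Y interior_subset unfolding convex_body_def by blast
  have on: "H (\<gamma> t) = 0 \<and> \<gamma> t \<in> Y" if "t \<in> {0..1}" for t
  proof -
    have "\<gamma> t \<in> frontier Y"
      using \<gamma> that unfolding closed_characteristic_def path_image_def by blast
    then have "H (\<gamma> t) = 0" using H unfolding defining_function_def by blast
    then show ?thesis using H unfolding defining_function_def by force
  qed
  have pos: "0 \<le> omega (\<gamma> t - z) (D t)" if t: "t \<in> {0..1}" for t
  proof -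
    have diff: "H differentiable at (\<gamma> t)" by (rule defining_function_differentiable[OF H])
    obtain w0 where "frechet_derivative H (at (\<gamma> t)) w0 \<noteq> 0"
      using H on[OF t] unfolding defining_function_def by blast
    then obtain l where l: "D t = l *\<^sub>R hamiltonian_field H (\<gamma> t)"
      using characteristic_line_hamiltonian[OF diff] char[OF t] by blast
    have "0 < l * (hamiltonian_field H (\<gamma> t) \<bullet> hamiltonian_field H (\<gamma> t))"
      using char[OF t] l by simp
    then have "0 \<le> l" by (smt (verit) inner_ge_zero mult_nonpos_nonneg)
    moreover have "omega (\<gamma> t - z) (D t) = l * frechet_derivative H (at (\<gamma> t)) (\<gamma> t - z)"
      by (subst omega_skew)
         (simp only: l omega_linear(5) omega_hamiltonian_field[OF diff] mult_minus_right minus_minus)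
    moreover have "0 \<le> frechet_derivative H (at (\<gamma> t)) (\<gamma> t - z)"
      using outward_derivative_nonneg[OF _ H _ _ z] on[OF t] Y by (simp add: convex_body_def)
    ultimately show ?thesis by simp
  qed
  have cont\<gamma>: "continuous_on {0..1} \<gamma>"
    using D by (intro continuous_at_imp_continuous_on ballI has_vector_derivative_continuous)
  have "(\<lambda>t. omega (\<gamma> t - z) (D t)) integrable_on {0..1}"
    unfolding omega_inner
    by (intro integrable_continuous_interval continuous_intros cont\<gamma> contD)
  then obtain J where J: "((\<lambda>t. omega (\<gamma> t - z) (D t)) has_integral J) {0..1}"
    unfolding integrable_on_def by blast
  have J0: "0 \<le> J" by (rule has_integral_nonneg[OF J]) (rule pos)
  \<comment> \<open>\<open>p dq - omega (\<gamma> - z) \<gamma>' / 2\<close> is the derivative of this function, which agrees at both ends of the loop\<close>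
  define h where "h t = fst (\<gamma> t - z) \<bullet> snd (\<gamma> t - z) / 2 + fst z \<bullet> snd (\<gamma> t)" for t
  have "((\<lambda>t. (fst (D t) \<bullet> snd (\<gamma> t - z) + fst (\<gamma> t - z) \<bullet> snd (D t)) / 2 + fst z \<bullet> snd (D t))
      has_integral h 1 - h 0) {0..1}"
  proof (rule fundamental_theorem_of_calculus)
    fix t :: real assume "t \<in> {0..1}"
    then have "(\<gamma> has_derivative (\<lambda>s. s *\<^sub>R D t)) (at t within {0..1})"
      using D has_vector_derivative_def has_derivative_at_withinI by blast
    then show "(h has_vector_derivative (fst (D t) \<bullet> snd (\<gamma> t - z) + fst (\<gamma> t - z) \<bullet> snd (D t)) / 2
        + fst z \<bullet> snd (D t)) (at t within {0..1})"
      unfolding h_def has_vector_derivative_def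
      by (auto intro!: derivative_eq_intros simp: fun_eq_iff field_simps inner_simps inner_commute)
  qed simp
  then have "((\<lambda>t. omega (\<gamma> t - z) (D t) / 2 + ((fst (D t) \<bullet> snd (\<gamma> t - z) + fst (\<gamma> t - z) \<bullet> snd (D t)) / 2 + fst z \<bullet> snd (D t)))
      has_integral J / 2 + 0) {0..1}"
    by (intro has_integral_add has_integral_divide J) (simp add: h_def closed)
  then have "((\<lambda>t. fst (\<gamma> t) \<bullet> snd (vector_derivative \<gamma> (at t))) has_integral J / 2 + 0) {0..1}"
    by (rule has_integral_eq[rotated])
       (simp add: vd omega_inner algebra_simps add_divide_distrib diff_divide_distrib inner_commute)
  then show ?thesis using J0 by (simp add: action_def integral_unique)
qed

text \<open>The functional \<open>l t = sin omega u - cos omega v\<close> is at most \<open>omega u v\<close> on the cylinder by the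
  Cauchy--Schwarz inequality, with equality at \<open>\<gamma> t\<close>.  So it is normal to \<open>Y\<close> there, and
  contracting \<open>omega\<close> with the velocity of the circle gives \<open>- 2 \<pi> l t\<close>, as
  required of a positive multiple of the Hamiltonian vector.  The action is the
  symplectic area \<open>\<pi> omega u v\<close> of the disc.\<close>
lemma circle_closed_characteristic:
  fixes u v :: "'n::finite phase" and Y
  defines "\<gamma> \<equiv> \<lambda>t. cos (2 * pi * t) *\<^sub>R u + sin (2 * pi * t) *\<^sub>R v"
  assumes Y: "smooth_convex_body Y" and k: "0 < omega u v"
    and cyl: "\<And>z. z \<in> Y \<Longrightarrow> (omega u z)\<^sup>2 + (omega v z)\<^sup>2 \<le> (omega u v)\<^sup>2"
    and circle: "\<And>t. \<gamma> t \<in> Y"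
  shows "closed_characteristic Y \<gamma>" "action \<gamma> = pi * omega u v"
proof -
  obtain H where H: "defining_function Y H" using Y unfolding smooth_convex_body_def by blast
  define c s where "c t = cos (2 * pi * t)" and "s t = sin (2 * pi * t)" for t :: real
  have cs: "(c t)\<^sup>2 + (s t)\<^sup>2 = 1" for t by (simp add: c_def s_def)
  define D where "D t = (2 * pi) *\<^sub>R (c t *\<^sub>R v - s t *\<^sub>R u)" for t
  have \<gamma>_eq: "\<gamma> t = c t *\<^sub>R u + s t *\<^sub>R v" for t by (simp add: \<gamma>_def c_def s_def)
  have dc: "(c has_real_derivative - (2 * pi * s t)) (at t within S)" for t S
    unfolding c_def s_def by (auto intro!: derivative_eq_intros)
  have ds: "(s has_real_derivative 2 * pi * c t) (at t within S)" for t S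
    unfolding c_def s_def by (auto intro!: derivative_eq_intros)
  have D: "(\<gamma> has_vector_derivative D t) (at t)" for t
    unfolding \<gamma>_eq D_def
    by (auto intro!: derivative_eq_intros dc ds simp: algebra_simps)
  have vd: "vector_derivative \<gamma> (at t) = D t" for t using D by (rule vector_derivative_at)
  define l where "l t w = s t * omega u w - c t * omega v w" for t w
  have lin: "linear (l t)" for t
    by (rule linearI) (simp_all add: l_def algebra_simps)
  have vu: "omega v u = - omega u v" by (rule omega_skew)
  have l\<gamma>: "l t (\<gamma> t) = omega u v" for t
  proof -
    have "l t (\<gamma> t) = ((c t)\<^sup>2 + (s t)\<^sup>2) * omega u v"
      by (simp add: l_def \<gamma>_eq vu power2_eq_square algebra_simps)
    then show ?thesis by (simp add: cs)
  qed
  have sup: "l t w \<le> l t (\<gamma> t)" if "w \<in> Y" for t w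
  proof -
    have "(l t w)\<^sup>2 + (c t * omega u w + s t * omega v w)\<^sup>2
        = ((c t)\<^sup>2 + (s t)\<^sup>2) * ((omega u w)\<^sup>2 + (omega v w)\<^sup>2)"
      by (simp add: l_def power2_eq_square algebra_simps)
    also have "\<dots> \<le> (omega u v)\<^sup>2" using cyl[OF that] by (simp add: cs)
    finally have "(l t w)\<^sup>2 \<le> (omega u v)\<^sup>2"
      by (smt (verit) zero_le_power2)
    then show ?thesis unfolding l\<gamma> using k by (simp add: abs_le_square_iff[symmetric])
  qed
  have omega_D: "omega (D t) w = - (2 * pi * l t w)" for t w
    by (simp add: D_def l_def algebra_simps)
  note touch = supporting_functional_derivative[OF H circle lin _ sup]
  have nz: "l t (\<gamma> t) \<noteq> 0" for t using k l\<gamma> by simp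
  have front: "\<gamma> t \<in> frontier Y" for t
    using touch(1)[OF nz] H unfolding defining_function_def by blast
  have "D t \<noteq> 0 \<and> D t \<in> characteristic_line H (\<gamma> t) \<and> 0 < D t \<bullet> hamiltonian_field H (\<gamma> t)" for t
  proof -
    obtain a where a: "0 < a" "\<And>w. l t w = a * frechet_derivative H (at (\<gamma> t)) w"
      using touch(2)[OF nz] by blast
    have D0: "D t \<noteq> 0"
    proof
      assume "D t = 0"
      then have "l t (\<gamma> t) = 0" using omega_D[of t "\<gamma> t"] by (simp add: omega_inner)
      then show False using nz by simp
    qed
    have "l t (D t) = 0" using omega_D[of t "D t"] by simp
    then have tangent: "frechet_derivative H (at (\<gamma> t)) (D t) = 0" using a by simp
    have "omega (D t) w = omega ((2 * pi * a) *\<^sub>R hamiltonian_field H (\<gamma> t)) w" for w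
      by (simp add: omega_D a(2) omega_hamiltonian_field[OF defining_function_differentiable[OF H]])
    then have "D t = (2 * pi * a) *\<^sub>R hamiltonian_field H (\<gamma> t)"
      by (rule omega_nondegenerate)
    then have "(2 * pi * a) * (D t \<bullet> hamiltonian_field H (\<gamma> t)) = D t \<bullet> D t"
      by (metis inner_scaleR_right)
    then have "0 < D t \<bullet> hamiltonian_field H (\<gamma> t)"
      using D0 a(1) by (metis inner_gt_zero_iff mult_pos_pos pi_gt_zero zero_less_mult_pos zero_less_numeral)
    then show ?thesis
      using D0 tangent omega_D a(2)
      by (simp add: characteristic_line_def tangent_hyperplane_def)
  qed
  moreover have "\<gamma> C1_differentiable_on {0..1}"
    unfolding C1_differentiable_on_def
    by (intro exI[of _ D] conjI ballI D) (auto simp: D_def c_def s_def intro!: continuous_intros)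
  ultimately show "closed_characteristic Y \<gamma>"
    unfolding closed_characteristic_def Let_def vd using front H
    by (auto simp: path_image_def pathstart_def pathfinish_def \<gamma>_def)
  \<comment> \<open>antiderivative of \<open>p dq\<close>, from \<open>2 \<pi> cos\<^sup>2 = (\<pi> t + sin cos / 2)'\<close> and \<open>2 \<pi> sin\<^sup>2 = (\<pi> t - sin cos / 2)'\<close>\<close>
  define \<Phi> where "\<Phi> t = (s t)\<^sup>2 * (fst v \<bullet> snd v - fst u \<bullet> snd u) / 2
      + (pi * t + s t * c t / 2) * (fst u \<bullet> snd v) - (pi * t - s t * c t / 2) * (fst v \<bullet> snd u)" for t
  have "((\<lambda>t. fst (\<gamma> t) \<bullet> snd (D t)) has_integral \<Phi> 1 - \<Phi> 0) {0..1}"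
  proof (rule fundamental_theorem_of_calculus)
    fix t :: real
    have c2: "2 * pi * (c t * c t) = pi + pi * (c t * c t) - pi * (s t * s t)"
      and s2: "2 * pi * (s t * s t) = pi - pi * (c t * c t) + pi * (s t * s t)"
    proof -
      have "pi * (c t * c t) + pi * (s t * s t) = pi"
        using cs[of t] by (simp add: power2_eq_square distrib_left[symmetric])
      then show "2 * pi * (c t * c t) = pi + pi * (c t * c t) - pi * (s t * s t)"
        "2 * pi * (s t * s t) = pi - pi * (c t * c t) + pi * (s t * s t)" by simp_all
    qed
    have "fst (\<gamma> t) \<bullet> snd (D t) = 2 * pi * (s t * c t) * (fst v \<bullet> snd v - fst u \<bullet> snd u)
        + 2 * pi * (c t * c t) * (fst u \<bullet> snd v) - 2 * pi * (s t * s t) * (fst v \<bullet> snd u)"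
      by (simp add: \<gamma>_eq D_def algebra_simps)
    also have "\<dots> = (2 * s t * (2 * pi * c t)) * (fst v \<bullet> snd v - fst u \<bullet> snd u) / 2
        + (pi + (2 * pi * c t * c t + s t * - (2 * pi * s t)) / 2) * (fst u \<bullet> snd v)
        - (pi - (2 * pi * c t * c t + s t * - (2 * pi * s t)) / 2) * (fst v \<bullet> snd u)"
      unfolding c2 s2 by (simp add: field_simps)
    finally have eq: "fst (\<gamma> t) \<bullet> snd (D t) = \<dots>" .
    show "(\<Phi> has_vector_derivative fst (\<gamma> t) \<bullet> snd (D t)) (at t within {0..1})"
      unfolding \<Phi>_def has_real_derivative_iff_has_vector_derivative[symmetric] eq
      by (auto intro!: derivative_eq_intros dc ds simp: field_simps)
  qed simp
  moreover have "\<Phi> 1 - \<Phi> 0 = pi * omega u v"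
    by (simp add: \<Phi>_def c_def s_def omega_inner algebra_simps)
  ultimately show "action \<gamma> = pi * omega u v"
    by (simp add: action_def vd integral_unique)
qed

lemma minimal_action_nonneg:
  assumes "smooth_convex_body Y"
  shows "0 \<le> minimal_action Y"
  using assms action_nonneg unfolding minimal_action_def smooth_convex_body_def
  by (auto intro!: INF_greatest)

lemma EHZ_capacity_nonneg: "0 \<le> EHZ_capacity X"
proof (cases "smooth_convex_body X")
  case False
  have "0 \<le> Liminf (smooth_bodies_near X) minimal_action"
    by (rule Liminf_bounded)
       (auto simp: eventually_smooth_bodies_near minimal_action_nonneg intro!: exI[of _ 1])
  then show ?thesis using False by (simp add: EHZ_capacity_def)
qed (simp add: EHZ_capacity_def minimal_action_nonneg)

text \<open>For an upper bound of a lower limit it is enough that bodies with small minimal action occur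
  arbitrarily close to \<open>X\<close>.\<close>
lemma EHZ_capacity_le:
  assumes "smooth_convex_body X \<Longrightarrow> minimal_action X \<le> L"
    and "\<And>e. 0 < e \<Longrightarrow> \<exists>Y. smooth_convex_body Y \<and> hausdorff_dist Y X < e \<and> minimal_action Y \<le> L"
  shows "EHZ_capacity X \<le> L"
proof -
  have "Liminf (smooth_bodies_near X) minimal_action \<le> L"
    unfolding Liminf_def
  proof (rule SUP_least)
    fix P assume "P \<in> {P. eventually P (smooth_bodies_near X)}"
    then obtain e where "0 < e" "\<And>Y. smooth_convex_body Y \<Longrightarrow> hausdorff_dist Y X < e \<Longrightarrow> P Y"
      unfolding eventually_smooth_bodies_near by auto
    then obtain Y where "P Y" "minimal_action Y \<le> L" using assms(2) by metis
    then show "Inf (minimal_action ` Collect P) \<le> L"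
      by (meson INF_lower mem_Collect_eq order_trans)
  qed
  then show ?thesis using assms(1) by (simp add: EHZ_capacity_def)
qed

section \<open>Viterbo's inequality\<close>

lemma quadratic_gauge_of_proper:
  fixes f :: "'a::euclidean_space \<Rightarrow> real"
  assumes convex: "convex_on UNIV f" and proper: "proper_fun f" and hom: "even_2homogeneous f"
  shows "quadratic_gauge f"
proof
  show scale: "f (t *\<^sub>R x) = t\<^sup>2 * f x" for t x using hom by (simp add: even_2homogeneous_def)
  show "0 < f x" if "x \<noteq> 0" for x
  proof -
    have "\<forall>\<^sub>F y in at_infinity. 1 \<le> f y"
      using proper unfolding proper_fun_def filterlim_at_top by blast
    then obtain b where b: "\<And>y. b \<le> norm y \<Longrightarrow> 1 \<le> f y" unfolding eventually_at_infinity by blast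
    have "1 \<le> f ((\<bar>b\<bar> / norm x) *\<^sub>R x)" using that by (intro b) simp
    then have "0 < (\<bar>b\<bar> / norm x)\<^sup>2 * f x" by (simp add: scale)
    then show ?thesis by (auto simp: zero_less_mult_iff)
  qed
qed (rule convex)

lemma quadratic_gauge_separable_sum:
  assumes "quadratic_gauge T" "quadratic_gauge V"
  shows "quadratic_gauge (\<lambda>z. T (fst z) + V (snd z))"
proof -
  interpret T: quadratic_gauge T by fact
  interpret V: quadratic_gauge V by fact
  show ?thesis
  proof
    show "convex_on UNIV (\<lambda>z. T (fst z) + V (snd z))"
    proof (rule convex_onI)
      fix t x y assume t: "(0::real) < t" "t < 1"
      show "T (fst ((1 - t) *\<^sub>R x + t *\<^sub>R y)) + V (snd ((1 - t) *\<^sub>R x + t *\<^sub>R y))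
        \<le> (1 - t) * (T (fst x) + V (snd x)) + t * (T (fst y) + V (snd y))"
        using convex_onD[OF T.convex, of t "fst x" "fst y"] convex_onD[OF V.convex, of t "snd x" "snd y"] t
        by (simp add: algebra_simps)
    qed simp
    show "T (fst (t *\<^sub>R x)) + V (snd (t *\<^sub>R x)) = t\<^sup>2 * (T (fst x) + V (snd x))" for t x
      by (simp add: T.scale V.scale algebra_simps)
    show "0 < T (fst x) + V (snd x)" if "x \<noteq> 0" for x
      using that T.pos[of "fst x"] V.pos[of "snd x"] T.nonneg[of "fst x"] V.nonneg[of "snd x"]
      by (cases "fst x = 0") (auto simp: prod_eq_iff intro: add_pos_nonneg add_nonneg_pos)
  qed
qed

text \<open>The inequality \<open>F\<^sup>L \<ge> Q\<close> dualizes to \<open>F \<le> Q\<^sup>L\<close>, where \<open>Q\<^sup>L x = \<bar>u\<bar>\<^sup>2 / 4\<close> if \<open>u\<close> is the transpose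
  of \<open>N\<close> applied to \<open>x\<close>.  Only one inequality of the biconjugate theorem enters: a subgradient \<open>y\<close> at
  \<open>x\<close> satisfies \<open>F\<^sup>L y \<le> F x\<close>, hence \<open>Q y \<le> F x\<close>.\<close>
lemma (in quadratic_gauge) conjugate_upper_bound:
  assumes Q: "\<And>y. ereal (Q y) \<le> legendre F y"
    and norm: "\<And>v. Q (N v) = v \<bullet> v" and surj: "\<And>y. \<exists>v. y = N v"
    and dual: "\<And>v. N v \<bullet> x = v \<bullet> u"
  shows "F x \<le> u \<bullet> u / 4"
proof -
  obtain y where y: "y \<bullet> x = 2 * F x" "\<And>z. y \<bullet> z \<le> F z + F x" using subgradient by blast
  obtain v where v: "y = N v" using surj by blast
  have "legendre F y \<le> ereal (F x)"
    unfolding legendre_def using y(2) by (intro SUP_least) (simp add: algebra_simps)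
  then have "v \<bullet> v \<le> F x" using Q[of y] order_trans by (fastforce simp: v norm)
  moreover have "2 * F x = v \<bullet> u" using y(1) dual by (simp add: v)
  moreover have "0 \<le> (v - (1 / 2) *\<^sub>R u) \<bullet> (v - (1 / 2) *\<^sub>R u)" by simp
  ultimately show ?thesis by (simp add: inner_diff inner_commute)
qed

lemma legendre_upper: "legendre f y = ereal m \<Longrightarrow> y \<bullet> x - m \<le> f x"
proof -
  assume "legendre f y = ereal m"
  moreover have "ereal (y \<bullet> x - f x) \<le> legendre f y"
    unfolding legendre_def by (rule SUP_upper) simp
  ultimately show ?thesis by simp
qed

theorem theorem2p2:
  fixes T V :: "real ^ 'n \<Rightarrow> real"
    and Q :: "real ^ 'n \<Rightarrow> real"
    and C E :: real
  assumes "\<And>x. 0 \<le> T x" and "\<And>x. 0 \<le> V x"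
    and "convex_on UNIV T" and "convex_on UNIV V"
    and "proper_fun T" and "proper_fun V"
    and "even_2homogeneous T" and "even_2homogeneous V"
    and "\<And>q. legendre T q \<ge> ereal (C * V q)"
    and "\<exists>q0. q0 \<noteq> 0 \<and> legendre T q0 = ereal (C * V q0)"
    and "positive_definite_quadratic_form Q"
    and "\<And>q. legendre T q \<ge> ereal (Q q)"
    and "\<And>q. Q q \<ge> C * V q"
    and "E > 0"
  shows "ereal (measure lebesgue {(p, q). T p + V q \<le> E})
       \<ge> EHZ_capacity {(p, q). T p + V q \<le> E} ^ CARD('n) / ereal (fact CARD('n))"
proof -
  interpret T: quadratic_gauge T by (rule quadratic_gauge_of_proper) fact+
  interpret V: quadratic_gauge V by (rule quadratic_gauge_of_proper) fact+
  define F where "F z = T (fst z) + V (snd z)" for z :: "'n phase"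
  interpret F: quadratic_gauge F
    unfolding F_def by (rule quadratic_gauge_separable_sum) unfold_locales
  define X where "X = {z. F z \<le> E}"
  have X_eq: "{(p, q). T p + V q \<le> E} = X" by (auto simp: X_def F_def)
  have E: "0 < E" by fact
  obtain N :: "real ^ 'n ^ 'n" where N: "invertible N" "\<And>v. Q (N *v v) = v \<bullet> v"
    using quadratic_form_normalization[OF assms(11)] by blast
  obtain P where "N ** P = mat 1" "P ** N = mat 1" using N(1) unfolding invertible_def by blast
  then have PN: "P *v (N *v v) = v" and NP: "N *v (P *v v) = v" for v
    by (simp_all add: matrix_vector_mul_assoc)
  define W where "W = transpose P"
  have WN: "(W *v u) \<bullet> (N *v v) = u \<bullet> v" for u v
    by (simp add: W_def dot_lmul_matrix PN)
  obtain q0 where q0: "q0 \<noteq> 0" "legendre T q0 = ereal (C * V q0)" using assms(10) by blast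
  define m where "m = Q q0"
  have m_eq: "C * V q0 = m"
    using assms(12)[of q0] assms(13)[of q0] q0(2) by (simp add: m_def)
  define v0 where "v0 = P *v q0"
  have Nv0: "N *v v0 = q0" by (simp add: v0_def NP)
  have v0: "v0 \<bullet> v0 = m" using N(2)[of v0] by (simp add: Nv0 m_def)
  have m: "0 < m" using assms(11) q0(1) by (simp add: m_def positive_definite_quadratic_form_def)
  have "0 < V q0" by (rule V.pos[OF q0(1)])
  then have C: "0 < C" using m m_eq zero_less_mult_pos2 by metis

  have T_upper: "T (W *v u) \<le> u \<bullet> u / 4" for u
    using T.conjugate_upper_bound[OF assms(12) N(2)] NP WN by (metis inner_commute)
  have V_upper: "C * V (N *v v) \<le> v \<bullet> v" for v
    using assms(13)[of "N *v v"] by (simp add: N(2))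
  have T_lower: "(q0 \<bullet> p)\<^sup>2 / (4 * m) \<le> T p" for p
    using legendre_upper[OF q0(2)] m unfolding m_eq
    by (intro square_le_of_linear_le T.scale T.nonneg) auto
  have V_lower: "((W *v v0) \<bullet> q)\<^sup>2 / m \<le> C * V q" for q
  proof -
    have convex: "convex_on UNIV (\<lambda>v. C * V (N *v v))"
    proof (rule convex_onI)
      fix t x y assume t: "(0::real) < t" "t < 1"
      have "V (N *v ((1 - t) *\<^sub>R x + t *\<^sub>R y)) \<le> (1 - t) * V (N *v x) + t * V (N *v y)"
        using convex_onD[OF V.convex, of t "N *v x" "N *v y"] t
        by (simp add: matrix_vector_right_distrib matrix_vector_mult_scaleR)
      then have "C * V (N *v ((1 - t) *\<^sub>R x + t *\<^sub>R y)) \<le> C * ((1 - t) * V (N *v x) + t * V (N *v y))"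
        using C by simp
      then show "C * V (N *v ((1 - t) *\<^sub>R x + t *\<^sub>R y)) \<le> (1 - t) * (C * V (N *v x)) + t * (C * V (N *v y))"
        by (simp add: algebra_simps)
    qed simp
    have "2 * (v0 \<bullet> v) - v0 \<bullet> v0 \<le> C * V (N *v v)" for v
      by (rule linear_le_of_touching_norm[OF convex V_upper]) (simp add: Nv0 m_eq v0)
    then have "((2 *\<^sub>R v0) \<bullet> v)\<^sup>2 / (4 * m) \<le> C * V (N *v v)" for v
      using C m by (intro square_le_of_linear_le)
        (auto simp: matrix_vector_mult_scaleR V.scale V.nonneg v0)
    from this[of "P *v q"] show ?thesis using WN[of v0 "P *v q"] by (simp add: NP power_mult_distrib)
  qed

  \<comment> \<open>the factors that put \<open>\<alpha> W v0\<close> and \<open>\<beta> q0\<close> on the energy levels \<open>T = E\<close> and \<open>V = E\<close>\<close>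
  define \<alpha> \<beta> where "\<alpha> = 2 * sqrt (E / m)" and "\<beta> = sqrt (C * E / m)"
  have \<alpha>2: "\<alpha>\<^sup>2 = 4 * E / m" and \<beta>2: "\<beta>\<^sup>2 = C * E / m"
    using E m C by (simp_all add: \<alpha>_def \<beta>_def power_mult_distrib)
  have \<alpha>\<beta>: "0 < \<alpha>" "0 < \<beta>" using E m C by (simp_all add: \<alpha>_def \<beta>_def)
  define u v :: "'n phase" where "u = (\<alpha> *\<^sub>R (W *v v0), 0)" and "v = (0, \<beta> *\<^sub>R q0)"
  define \<kappa> where "\<kappa> = 2 * sqrt C * E"
  have \<kappa>: "0 < \<kappa>" using C E by (simp add: \<kappa>_def)
  have uv: "omega u v = \<kappa>"
  proof -
    have "omega u v = \<alpha> * \<beta> * m" using WN[of v0 v0] by (simp add: omega_inner u_def v_def Nv0 v0)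
    also have "\<alpha> * \<beta> * m = 2 * sqrt ((E / m) * (C * E / m)) * m"
      by (simp only: \<alpha>_def \<beta>_def real_sqrt_mult mult.assoc)
    also have "(E / m) * (C * E / m) = C * (E / m)\<^sup>2" by (simp add: power2_eq_square)
    also have "2 * sqrt (C * (E / m)\<^sup>2) * m = \<kappa>" using E m by (simp add: \<kappa>_def real_sqrt_mult)
    finally show ?thesis .
  qed
  \<comment> \<open>the quadratic form of the cylinder as a sum of two squares, scaled so that the cylinder is its sublevel set at height \<open>E\<close>\<close>
  define J where "J = {(1 / (2 * sqrt (C * E))) *\<^sub>R (0, \<alpha> *\<^sub>R (W *v v0)), (1 / (2 * sqrt (C * E))) *\<^sub>R (- \<beta> *\<^sub>R q0, 0)}"
  have finJ: "finite J" by (simp add: J_def)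
  have sumJ: "(\<Sum>b\<in>J. (b \<bullet> z)\<^sup>2) = ((omega u z)\<^sup>2 + (omega v z)\<^sup>2) / (4 * (C * E))" for z
  proof -
    have "(\<Sum>b\<in>J. (b \<bullet> z)\<^sup>2) = ((1 / (2 * sqrt (C * E))) * omega u z)\<^sup>2 + ((1 / (2 * sqrt (C * E))) * omega v z)\<^sup>2"
      using q0(1) \<alpha>\<beta> C E
      by (simp add: J_def omega_inner u_def v_def inner_prod_def inner_commute)
    then show ?thesis using C E by (simp add: power_mult_distrib power_divide add_divide_distrib)
  qed
  have J_le: "(\<Sum>b\<in>J. (b \<bullet> z)\<^sup>2) \<le> F z" for z
  proof -
    have "(omega u z)\<^sup>2 / (4 * (C * E)) = ((W *v v0) \<bullet> snd z)\<^sup>2 / m / C"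
      using E by (simp add: omega_inner u_def power_mult_distrib \<alpha>2)
    also have "\<dots> \<le> V (snd z)" using divide_right_mono[OF V_lower[of "snd z"], of C] C by simp
    finally have 1: "(omega u z)\<^sup>2 / (4 * (C * E)) \<le> V (snd z)" .
    have "(omega v z)\<^sup>2 / (4 * (C * E)) = (q0 \<bullet> fst z)\<^sup>2 / (4 * m)"
      using E C by (simp add: omega_inner v_def power_mult_distrib \<beta>2 inner_commute)
    then show ?thesis using 1 T_lower[of "fst z"] unfolding sumJ F_def by (simp add: add_divide_distrib)
  qed
  have circle: "cos t *\<^sub>R u + sin t *\<^sub>R v \<in> X" for t
  proof -
    have "T (W *v v0) \<le> m / 4" using T_upper[of v0] by (simp add: v0)
    then have "(cos t * \<alpha>)\<^sup>2 * T (W *v v0) \<le> (cos t * \<alpha>)\<^sup>2 * (m / 4)" by (intro mult_left_mono) auto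
    also have "\<dots> = (cos t)\<^sup>2 * E" using m by (simp add: power_mult_distrib \<alpha>2)
    finally have 1: "(cos t * \<alpha>)\<^sup>2 * T (W *v v0) \<le> (cos t)\<^sup>2 * E" .
    have "V q0 = m / C" using m_eq C by (simp add: field_simps)
    then have 2: "(sin t * \<beta>)\<^sup>2 * V q0 = (sin t)\<^sup>2 * E" using m C by (simp add: power_mult_distrib \<beta>2)
    have "F (cos t *\<^sub>R u + sin t *\<^sub>R v) = (cos t * \<alpha>)\<^sup>2 * T (W *v v0) + (sin t * \<beta>)\<^sup>2 * V q0"
      by (simp add: F_def u_def v_def T.scale V.scale)
    also have "\<dots> \<le> ((cos t)\<^sup>2 + (sin t)\<^sup>2) * E" unfolding distrib_right 2 using 1 by (rule add_right_mono)
    finally show ?thesis by (simp add: X_def)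
  qed

  have action: "minimal_action Y \<le> ereal (pi * \<kappa>)"
    if Y: "smooth_convex_body Y" "X \<subseteq> Y" "Y \<subseteq> {z. (\<Sum>b\<in>J. (b \<bullet> z)\<^sup>2) \<le> E}" for Y
  proof -
    have cyl: "(omega u z)\<^sup>2 + (omega v z)\<^sup>2 \<le> (omega u v)\<^sup>2" if "z \<in> Y" for z
    proof -
      have "((omega u z)\<^sup>2 + (omega v z)\<^sup>2) / (4 * (C * E)) \<le> E" using Y(3) that sumJ by auto
      then have "(omega u z)\<^sup>2 + (omega v z)\<^sup>2 \<le> E * (4 * (C * E))" using C E by (simp add: divide_le_eq)
      also have "\<dots> = \<kappa>\<^sup>2"
        using C by (simp add: \<kappa>_def power_mult_distrib power2_eq_square[of E])
      finally show ?thesis by (simp add: uv)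
    qed
    have "0 < omega u v" "\<And>t. cos (2 * pi * t) *\<^sub>R u + sin (2 * pi * t) *\<^sub>R v \<in> Y"
      using uv \<kappa> circle Y(2) by auto
    note char = circle_closed_characteristic[OF Y(1) this(1) cyl this(2)]
    have "minimal_action Y \<le> ereal (action (\<lambda>t. cos (2 * pi * t) *\<^sub>R u + sin (2 * pi * t) *\<^sub>R v))"
      unfolding minimal_action_def using char(1) by (intro INF_lower) simp
    then show ?thesis using char(2) uv by simp
  qed
  have cap_le: "EHZ_capacity X \<le> ereal (pi * \<kappa>)"
  proof (rule EHZ_capacity_le)
    show "minimal_action X \<le> ereal (pi * \<kappa>)" if "smooth_convex_body X"
      using action[OF that] J_le order_trans by (fastforce simp: X_def)
    show "\<exists>Y. smooth_convex_body Y \<and> hausdorff_dist Y X < e \<and> minimal_action Y \<le> ereal (pi * \<kappa>)"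
      if "0 < e" for e
      using F.smooth_bodies_nearby[OF E finJ J_le that] action unfolding X_def by metis
  qed

  \<comment> \<open>this scaling balances \<open>T (W p) / \<tau>\<^sup>2\<close> and \<open>\<tau>\<^sup>2 V (N q)\<close>: both are bounded by \<open>\<bar>\<cdot>\<bar>\<^sup>2 / (2 \<surd>C)\<close>\<close>
  define \<tau> where "\<tau> = sqrt (sqrt C / 2)"
  have \<tau>: "0 < \<tau>" "\<tau>\<^sup>2 = sqrt C / 2" using C by (simp_all add: \<tau>_def)
  define L where "L z = ((1 / \<tau>) *\<^sub>R (W *v fst z), \<tau> *\<^sub>R (N *v snd z))" for z :: "'n phase"
  have linL: "linear L"
    by (rule linearI) (simp_all add: L_def matrix_vector_right_distrib matrix_vector_mult_scaleR scaleR_right_distrib)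
  have symplectic: "omega (L x) (L y) = omega x y" for x y
    using \<tau>(1) by (simp add: omega_inner L_def WN)
  have L_sub: "L ` cball 0 (sqrt \<kappa>) \<subseteq> X"
  proof (rule image_subsetI)
    fix z :: "'n phase" assume z: "z \<in> cball 0 (sqrt \<kappa>)"
    obtain p q where pq_eq: "z = (p, q)" by (cases z)
    have pq: "p \<bullet> p + q \<bullet> q \<le> \<kappa>" using z \<kappa> by (simp add: pq_eq norm_prod_def dot_square_norm)
    have "T ((1 / \<tau>) *\<^sub>R (W *v p)) = T (W *v p) / (sqrt C / 2)"
      by (simp add: T.scale power_divide \<tau>(2))
    also have "\<dots> \<le> (p \<bullet> p / 4) / (sqrt C / 2)"
      using C by (intro divide_right_mono T_upper) simp
    also have "\<dots> = (p \<bullet> p) / (2 * sqrt C)" by simp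
    finally have "T ((1 / \<tau>) *\<^sub>R (W *v p)) \<le> (p \<bullet> p) / (2 * sqrt C)" .
    moreover have "V (\<tau> *\<^sub>R (N *v q)) \<le> (q \<bullet> q) / (2 * sqrt C)"
    proof -
      have "V (N *v q) \<le> (q \<bullet> q) / C" using V_upper[of q] C by (simp add: field_simps)
      then have "\<tau>\<^sup>2 * V (N *v q) \<le> \<tau>\<^sup>2 * ((q \<bullet> q) / C)" by (intro mult_left_mono) auto
      also have "\<dots> = (sqrt C / C) * (q \<bullet> q) / 2" by (simp add: \<tau>(2))
      also have "\<dots> = (q \<bullet> q) / (2 * sqrt C)"
        unfolding sqrt_divide_self_eq[OF less_imp_le[OF C]] inverse_eq_divide by simp
      finally show ?thesis by (simp add: V.scale)
    qed
    ultimately have "F (L (p, q)) \<le> (p \<bullet> p + q \<bullet> q) / (2 * sqrt C)"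
      by (simp add: F_def L_def add_divide_distrib)
    also have "\<dots> \<le> \<kappa> / (2 * sqrt C)" using pq C by (intro divide_right_mono) auto
    also have "\<dots> = E" using C by (simp add: \<kappa>_def)
    finally show "L z \<in> X" by (simp add: X_def pq_eq)
  qed
  have "compact X" unfolding X_def by (rule F.compact_sublevel)
  have "compact (L ` cball 0 (sqrt \<kappa>))"
    using linL by (intro compact_continuous_image linear_continuous_on compact_cball)
      (simp add: linear_conv_bounded_linear)
  have "(pi * \<kappa>) ^ CARD('n) / fact CARD('n) = measure lborel (L ` cball 0 (sqrt \<kappa>))"
    using measure_symplectic_image_cball[OF linL symplectic, of "sqrt \<kappa>"] \<kappa> by simp
  also have "\<dots> = measure lebesgue (L ` cball 0 (sqrt \<kappa>))"
    using borel_compact[OF \<open>compact (L ` cball 0 (sqrt \<kappa>))\<close>] by (simp add: measure_completion)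
  also have "\<dots> \<le> measure lebesgue X"
    by (rule measure_mono_fmeasurable[OF L_sub])
       (auto intro: fmeasurableD lmeasurable_compact \<open>compact X\<close> \<open>compact (L ` cball 0 (sqrt \<kappa>))\<close>)
  finally have vol: "(pi * \<kappa>) ^ CARD('n) / fact CARD('n) \<le> measure lebesgue X" .

  \<comment> \<open>nonnegativity is what allows taking the power \<open>n\<close> below\<close>
  obtain c where c: "EHZ_capacity X = ereal c" "0 \<le> c" "c \<le> pi * \<kappa>"
    using cap_le EHZ_capacity_nonneg[of X] by (cases "EHZ_capacity X") auto
  have "c ^ CARD('n) / fact CARD('n) \<le> (pi * \<kappa>) ^ CARD('n) / fact CARD('n)"
    using c by (intro divide_right_mono power_mono) auto
  also note vol
  finally show ?thesis unfolding X_eq c by simp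
qed

end
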